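(* Let $G$ be a non-abelian locally free group which has a free subgroup whose cardinality is the same as that of $G$ itself. (1) Let $R$ be a domain (a ring with identity and with no zero divisors, not necessarily commutative). If $|R|\leq |G|$, then the group ring $RG$ is primitive. (2) If $K$ is a field, then the group ring $KG$ is primitive.
   Context: A group is locally free if all of its finitely generated subgroups are free. A ring is (right) primitive if it has a faithful irreducible (right) module. $|S|$ denotes the cardinality of a set $S$. *)

theory Defs
  imports "HOL-Algebra.Generated_Groups" "HOL-Algebra.Module" "HOL-Library.Equipollence"
begin

section \<open>Free and locally free groups\<close>

text \<open>The letter \<open>(x, True)\<close> stands for \<open>x\<close>, and \<open>(x, False)\<close> for its inverse.\<close>

definition letter_val :: "('g, 'b) monoid_scheme \<Rightarrow> 'g \<times> bool \<Rightarrow> 'g" where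
  "letter_val G l = (if snd l then fst l else inv\<^bsub>G\<^esub> (fst l))"

definition word_val :: "('g, 'b) monoid_scheme \<Rightarrow> ('g \<times> bool) list \<Rightarrow> 'g" where
  "word_val G w = foldr (\<lambda>l a. letter_val G l \<otimes>\<^bsub>G\<^esub> a) w \<one>\<^bsub>G\<^esub>"

definition reduced_words :: "'g set \<Rightarrow> ('g \<times> bool) list set" where
  "reduced_words B = {w \<in> lists (B \<times> UNIV).
     successively (\<lambda>l m. \<not> (fst l = fst m \<and> snd l \<noteq> snd m)) w}"

text \<open>A group is free if it has a free basis \<open>B\<close>: each element is the value of exactly one
  reduced word in \<open>B\<close> and its inverses. The basis may be empty, so the trivial group is free.\<close>

definition free_group :: "('g, 'b) monoid_scheme \<Rightarrow> bool" where
  "free_group G \<longleftrightarrow> group G \<and>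
     (\<exists>B \<subseteq> carrier G. bij_betw (word_val G) (reduced_words B) (carrier G))"

definition locally_free_group :: "('g, 'b) monoid_scheme \<Rightarrow> bool" where
  "locally_free_group G \<longleftrightarrow> group G \<and>
     (\<forall>S. S \<subseteq> carrier G \<and> finite S \<longrightarrow> free_group (G\<lparr>carrier := generate G S\<rparr>))"

section \<open>Domains and group rings\<close>

text \<open>Unlike the library's \<^locale>\<open>domain\<close>, multiplication need not be commutative.\<close>

definition noncomm_domain :: "('r, 'a) ring_scheme \<Rightarrow> bool" where
  "noncomm_domain R \<longleftrightarrow> ring R \<and> \<one>\<^bsub>R\<^esub> \<noteq> \<zero>\<^bsub>R\<^esub> \<and>
     (\<forall>a \<in> carrier R. \<forall>b \<in> carrier R.
        a \<otimes>\<^bsub>R\<^esub> b = \<zero>\<^bsub>R\<^esub> \<longrightarrow> a = \<zero>\<^bsub>R\<^esub> \<or> b = \<zero>\<^bsub>R\<^esub>)"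

text \<open>The formal sum of the \<open>r\<^sub>g g\<close> is the finitely supported function \<open>g \<mapsto> r\<^sub>g\<close>, extended by
  zero outside \<open>carrier G\<close>. The coefficient of \<open>x\<close> in a product \<open>f h\<close> is the sum of the
  \<open>f(y) h(z)\<close> over \<open>y z = x\<close>, that is, with \<open>z = y\<inverse> x\<close> and \<open>y\<close> in the support of \<open>f\<close>.\<close>

definition group_ring ::
  "('r, 'a) ring_scheme \<Rightarrow> ('g, 'b) monoid_scheme \<Rightarrow> ('g \<Rightarrow> 'r) ring" where
  "group_ring R G =
    \<lparr> carrier = {f. (\<forall>x \<in> carrier G. f x \<in> carrier R) \<and> (\<forall>x. x \<notin> carrier G \<longrightarrow> f x = \<zero>\<^bsub>R\<^esub>) \<and>
                   finite {x \<in> carrier G. f x \<noteq> \<zero>\<^bsub>R\<^esub>}},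
      mult = (\<lambda>f h x. if x \<in> carrier G
                then \<Oplus>\<^bsub>R\<^esub>y \<in> {y \<in> carrier G. f y \<noteq> \<zero>\<^bsub>R\<^esub>}. f y \<otimes>\<^bsub>R\<^esub> h (inv\<^bsub>G\<^esub> y \<otimes>\<^bsub>G\<^esub> x)
                else \<zero>\<^bsub>R\<^esub>),
      one = (\<lambda>x. if x = \<one>\<^bsub>G\<^esub> then \<one>\<^bsub>R\<^esub> else \<zero>\<^bsub>R\<^esub>),
      zero = (\<lambda>x. \<zero>\<^bsub>R\<^esub>),
      add = (\<lambda>f h x. f x \<oplus>\<^bsub>R\<^esub> h x) \<rparr>"

section \<open>Primitive rings\<close>

text \<open>As for the library's modules, the underlying abelian group of \<open>M\<close> is the additive part of a
  ring record; its multiplicative part is irrelevant.\<close>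

locale right_module = R?: ring R + M?: abelian_group M
  for R :: "('r, 'a) ring_scheme" (structure) and M :: "('m, 'c) ring_scheme" (structure) +
  fixes act :: "'m \<Rightarrow> 'r \<Rightarrow> 'm"
  assumes act_closed: "\<lbrakk>x \<in> carrier M; a \<in> carrier R\<rbrakk> \<Longrightarrow> act x a \<in> carrier M"
    and act_add_left: "\<lbrakk>x \<in> carrier M; y \<in> carrier M; a \<in> carrier R\<rbrakk> \<Longrightarrow>
      act (x \<oplus>\<^bsub>M\<^esub> y) a = act x a \<oplus>\<^bsub>M\<^esub> act y a"
    and act_add_right: "\<lbrakk>x \<in> carrier M; a \<in> carrier R; b \<in> carrier R\<rbrakk> \<Longrightarrow>
      act x (a \<oplus>\<^bsub>R\<^esub> b) = act x a \<oplus>\<^bsub>M\<^esub> act x b"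
    and act_mult: "\<lbrakk>x \<in> carrier M; a \<in> carrier R; b \<in> carrier R\<rbrakk> \<Longrightarrow>
      act x (a \<otimes>\<^bsub>R\<^esub> b) = act (act x a) b"
    and act_one: "x \<in> carrier M \<Longrightarrow> act x \<one>\<^bsub>R\<^esub> = x"

definition right_submodule ::
  "'m set \<Rightarrow> ('r, 'a) ring_scheme \<Rightarrow> ('m, 'c) ring_scheme \<Rightarrow> ('m \<Rightarrow> 'r \<Rightarrow> 'm) \<Rightarrow> bool" where
  "right_submodule N R M act \<longleftrightarrow> subgroup N (add_monoid M) \<and>
     (\<forall>x \<in> N. \<forall>a \<in> carrier R. act x a \<in> N)"

definition irreducible_right_module ::
  "('r, 'a) ring_scheme \<Rightarrow> ('m, 'c) ring_scheme \<Rightarrow> ('m \<Rightarrow> 'r \<Rightarrow> 'm) \<Rightarrow> bool" where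
  "irreducible_right_module R M act \<longleftrightarrow> right_module R M act \<and> carrier M \<noteq> {\<zero>\<^bsub>M\<^esub>} \<and>
     (\<forall>N. right_submodule N R M act \<longrightarrow> N = {\<zero>\<^bsub>M\<^esub>} \<or> N = carrier M)"

definition faithful_right_module ::
  "('r, 'a) ring_scheme \<Rightarrow> ('m, 'c) ring_scheme \<Rightarrow> ('m \<Rightarrow> 'r \<Rightarrow> 'm) \<Rightarrow> bool" where
  "faithful_right_module R M act \<longleftrightarrow> right_module R M act \<and>
     (\<forall>a \<in> carrier R. (\<forall>x \<in> carrier M. act x a = \<zero>\<^bsub>M\<^esub>) \<longrightarrow> a = \<zero>\<^bsub>R\<^esub>)"

text \<open>The elements of the module have the type \<open>'r set\<close>. This is no restriction: an
  irreducible module is isomorphic to a quotient of \<open>R\<close> by a maximal right ideal, whose elements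
  are cosets. See \<open>right_primitiveI\<close> below.\<close>

definition right_primitive :: "('r, 'a) ring_scheme \<Rightarrow> bool" where
  "right_primitive R \<longleftrightarrow> ring R \<and> (\<exists>(M :: 'r set ring) act.
     irreducible_right_module R M act \<and> faithful_right_module R M act)"

lemma (in right_module) act_zero:
  assumes "x \<in> carrier M" shows "act x \<zero>\<^bsub>R\<^esub> = \<zero>\<^bsub>M\<^esub>"
proof -
  have c: "act x \<zero>\<^bsub>R\<^esub> \<in> carrier M" using assms by (simp add: act_closed)
  have "act x \<zero>\<^bsub>R\<^esub> \<oplus>\<^bsub>M\<^esub> act x \<zero>\<^bsub>R\<^esub> = act x \<zero>\<^bsub>R\<^esub>"
    using act_add_right[OF assms R.zero_closed R.zero_closed] by simp
  then show ?thesis using M.add.r_cancel_one[OF c c] by simp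
qed

lemma (in right_module) act_uminus:
  assumes "x \<in> carrier M" "a \<in> carrier R" shows "act x (\<ominus>\<^bsub>R\<^esub> a) = \<ominus>\<^bsub>M\<^esub> act x a"
  using act_add_right[OF assms(1) R.a_inv_closed[OF assms(2)] assms(2)] act_zero[OF assms(1)]
  by (metis assms act_closed R.a_inv_closed R.l_neg M.minus_equality)

lemma right_primitiveI:
  fixes R :: "('r, 'a) ring_scheme" and M :: "('m, 'c) ring_scheme"
  assumes irr: "irreducible_right_module R M act" and faith: "faithful_right_module R M act"
  shows "right_primitive R"
proof -
  interpret right_module R M act using irr by (simp add: irreducible_right_module_def)
  obtain m where m: "m \<in> carrier M" "m \<noteq> \<zero>\<^bsub>M\<^esub>"
    using irr M.zero_closed unfolding irreducible_right_module_def by blast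
  let ?N = "act m ` carrier R"
  have "subgroup ?N (add_monoid M)"
  proof (rule M.add.subgroupI)
    show "?N \<subseteq> carrier M" using m act_closed by auto
    show "?N \<noteq> {}" by auto
    show "\<ominus>\<^bsub>M\<^esub> x \<in> ?N" if "x \<in> ?N" for x
      using that m by (auto simp: act_uminus[symmetric])
    show "x \<oplus>\<^bsub>M\<^esub> y \<in> ?N" if "x \<in> ?N" "y \<in> ?N" for x y
      using that m by (auto simp: act_add_right[symmetric])
  qed
  then have "right_submodule ?N R M act"
    using m by (auto simp: right_submodule_def act_mult[symmetric])
  moreover have "m \<in> ?N" using act_one[OF m(1)] by (metis R.one_closed imageI)
  ultimately have N: "?N = carrier M"
    using irr m(2) unfolding irreducible_right_module_def by blast
  define \<phi> where "\<phi> x = {a \<in> carrier R. act m a = x}" for x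
  have inj: "inj_on \<phi> (carrier M)"
  proof (rule inj_onI)
    fix x y assume x: "x \<in> carrier M" and e: "\<phi> x = \<phi> y"
    obtain a where "a \<in> carrier R" "act m a = x" using x N by (metis imageE)
    then have "a \<in> \<phi> y" using e by (auto simp: \<phi>_def)
    then show "x = y" using \<open>act m a = x\<close> by (simp add: \<phi>_def)
  qed
  define \<psi> where "\<psi> = inv_into (carrier M) \<phi>"
  have \<psi>: "\<psi> (\<phi> x) = x" if "x \<in> carrier M" for x
    using that inj by (simp add: \<psi>_def)
  define M' :: "'r set ring" where "M' = \<lparr>carrier = \<phi> ` carrier M, mult = (\<lambda>x y. x), one = {},
     zero = \<phi> \<zero>\<^bsub>M\<^esub>, add = (\<lambda>x y. \<phi> (\<psi> x \<oplus>\<^bsub>M\<^esub> \<psi> y))\<rparr>"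
  define act' where "act' x a = \<phi> (act (\<psi> x) a)" for x a
  have sel: "carrier M' = \<phi> ` carrier M" "\<zero>\<^bsub>M'\<^esub> = \<phi> \<zero>\<^bsub>M\<^esub>"
    "\<And>x y. x \<oplus>\<^bsub>M'\<^esub> y = \<phi> (\<psi> x \<oplus>\<^bsub>M\<^esub> \<psi> y)" by (simp_all add: M'_def)
  have ab: "abelian_group M'"
  proof (rule abelian_groupI)
    show "\<exists>y \<in> carrier M'. y \<oplus>\<^bsub>M'\<^esub> x = \<zero>\<^bsub>M'\<^esub>" if xM: "x \<in> carrier M'" for x
    proof -
      obtain u where u: "u \<in> carrier M" "x = \<phi> u" using xM by (auto simp: sel)
      have "\<phi> (\<ominus>\<^bsub>M\<^esub> u) \<oplus>\<^bsub>M'\<^esub> x = \<zero>\<^bsub>M'\<^esub>" using u by (simp add: sel \<psi> M.l_neg)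
      then show ?thesis using u by (auto simp: sel)
    qed
  qed (auto simp: sel \<psi> M.a_assoc intro!: arg_cong[of _ _ \<phi>] M.a_comm)
  have rm: "right_module R M' act'"
    unfolding right_module_def right_module_axioms_def
    by (auto simp: ab R.ring_axioms sel act'_def \<psi> act_closed act_add_left act_add_right act_mult act_one)
  have "irreducible_right_module R M' act'"
    unfolding irreducible_right_module_def
  proof (intro conjI allI impI rm)
    show "carrier M' \<noteq> {\<zero>\<^bsub>M'\<^esub>}"
    proof
      assume "carrier M' = {\<zero>\<^bsub>M'\<^esub>}"
      moreover have "\<phi> m \<in> carrier M'" using m(1) by (simp add: sel)
      ultimately have "\<phi> m = \<phi> \<zero>\<^bsub>M\<^esub>" by (simp only: sel(2) singleton_iff)
      then show False using inj_on_eq_iff[OF inj m(1) M.zero_closed] m(2) by blast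
    qed
  next
    fix N assume N: "right_submodule N R M' act'"
    then have sg: "subgroup N (add_monoid M')"
      and cl: "\<And>x a. x \<in> N \<Longrightarrow> a \<in> carrier R \<Longrightarrow> act' x a \<in> N"
      by (auto simp: right_submodule_def)
    have sub: "N \<subseteq> \<phi> ` carrier M" using subgroup.subset[OF sg] by (simp add: sel)
    let ?P = "{x \<in> carrier M. \<phi> x \<in> N}"
    have PN: "\<phi> ` ?P = N" using sub by auto
    have "subgroup ?P (add_monoid M)"
    proof (rule M.add.subgroupI)
      show "?P \<subseteq> carrier M" by auto
      have z: "\<phi> \<zero>\<^bsub>M\<^esub> \<in> N" using subgroup.one_closed[OF sg] by (simp add: sel)
      then show "?P \<noteq> {}" by auto
      show "x \<oplus>\<^bsub>M\<^esub> y \<in> ?P" if "x \<in> ?P" "y \<in> ?P" for x y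
        using that subgroup.m_closed[OF sg, of "\<phi> x" "\<phi> y"] by (simp add: sel \<psi>)
      show "\<ominus>\<^bsub>M\<^esub> x \<in> ?P" if "x \<in> ?P" for x
      proof -
        have x: "x \<in> carrier M" using that by auto
        have "act x (\<ominus>\<^bsub>R\<^esub> \<one>\<^bsub>R\<^esub>) = \<ominus>\<^bsub>M\<^esub> x" using x act_one by (simp add: act_uminus)
        then have "act' (\<phi> x) (\<ominus>\<^bsub>R\<^esub> \<one>\<^bsub>R\<^esub>) = \<phi> (\<ominus>\<^bsub>M\<^esub> x)" using x by (simp add: act'_def \<psi>)
        then show ?thesis using cl[of "\<phi> x" "\<ominus>\<^bsub>R\<^esub> \<one>\<^bsub>R\<^esub>"] that by auto
      qed
    qed
    moreover have "act x a \<in> ?P" if "x \<in> ?P" "a \<in> carrier R" for x a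
      using that cl[of "\<phi> x" a] act_closed by (auto simp: act'_def \<psi>)
    ultimately have "right_submodule ?P R M act" by (auto simp: right_submodule_def)
    then have "?P = {\<zero>\<^bsub>M\<^esub>} \<or> ?P = carrier M"
      using irr unfolding irreducible_right_module_def by blast
    then show "N = {\<zero>\<^bsub>M'\<^esub>} \<or> N = carrier M'"
      proof
      assume "?P = {\<zero>\<^bsub>M\<^esub>}"
      then have "N = {\<zero>\<^bsub>M'\<^esub>}" using PN by (metis image_empty image_insert sel(2))
      then show ?thesis ..
    next
      assume "?P = carrier M"
      then have "N = carrier M'" using PN by (metis sel(1))
      then show ?thesis ..
    qed
  qed
  moreover have "faithful_right_module R M' act'"
    unfolding faithful_right_module_def
  proof (intro conjI ballI impI rm)
    fix a assume a: "a \<in> carrier R" "\<forall>x\<in>carrier M'. act' x a = \<zero>\<^bsub>M'\<^esub>"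
    have "act x a = \<zero>\<^bsub>M\<^esub>" if x: "x \<in> carrier M" for x
    proof -
      have "\<phi> (act x a) = \<phi> \<zero>\<^bsub>M\<^esub>" using a x by (auto simp: sel act'_def \<psi>)
      then show ?thesis using inj x a act_closed by (simp add: inj_on_eq_iff)
    qed
    then show "a = \<zero>\<^bsub>R\<^esub>" using faith a(1) unfolding faithful_right_module_def by blast
  qed
  ultimately show ?thesis unfolding right_primitive_def using R.ring_axioms by blast
qed

end

theory Submission
  imports Defs "HOL-Algebra.Free_Abelian_Groups" "HOL-Algebra.Ideal" "HOL-Algebra.Subrings"
begin

text \<open>A right ideal \<open>P\<close> of a ring \<open>S\<close> with \<open>1 \<notin> P\<close> and \<open>P + I = S\<close> for all nonzero ideals \<open>I\<close> yields
  primitivity: if \<open>Q\<close> is a maximal right ideal containing \<open>P\<close>, then \<open>S/Q\<close> is irreducible, and its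
  annihilator is an ideal contained in \<open>Q\<close>, hence zero. As in Formanek's work on free products, for
  \<open>S = RG\<close> the right ideal \<open>P\<close> is generated by elements \<open>\<epsilon>(b) + 1\<close>, where \<open>b\<close> runs through a set \<open>T\<close> of
  nonzero elements that meets every nonzero ideal, and \<open>\<epsilon>(b)\<close> lies in the ideal generated by \<open>b\<close>.

  Here \<open>\<epsilon>(b) = x\<^sub>b b z\<^sub>b\<close>. The element \<open>x\<^sub>b\<close> is a sum of five elements of a basis of a large free
  subgroup, distinct for distinct \<open>b\<close>; this is where \<open>|T| \<le> |G|\<close> is used. The element \<open>z\<^sub>b\<close> is a sum of
  three elements \<open>z\<close> such that, up to exceptions that affect at most one \<open>z\<close> for each \<open>g\<close>, the
  products \<open>s z g\<close> with \<open>s \<in> supp b\<close> are all distinct. Counting terms that cannot cancel gives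
  \<open>|supp (b z\<^sub>b r)| \<ge> |supp r|\<close> and \<open>|supp (\<Sum> x\<^sub>b c\<^sub>b)| \<ge> 3 \<Sum> |supp c\<^sub>b|\<close>. With \<open>c\<^sub>b = b z\<^sub>b r\<^sub>b\<close>, an equation
  \<open>\<Sum> (\<epsilon>(b) + 1) r\<^sub>b = 1\<close> would force all \<open>r\<^sub>b\<close> to vanish.

  For a domain with \<open>|R| \<le> |G|\<close> the set \<open>T\<close> consists of all nonzero elements. For a field of any
  cardinality it consists of the nonzero elements with coefficients in \<open>\<int> \<cdot> 1\<close>.\<close>

section \<open>Words in a free basis\<close>

text \<open>In the model case \<open>Z\<close> is a free basis of \<open>G\<close>, \<open>S = {1}\<close>, and \<open>A u\<close> consists of the elements
  whose reduced word does not begin with \<open>u\<^sup>-\<^sup>1\<close>, so that nothing cancels in \<open>u g\<close>.\<close>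

definition spread :: "('g, 'b) monoid_scheme \<Rightarrow> 'g set \<Rightarrow> 'g set \<Rightarrow> ('g \<Rightarrow> 'g set) \<Rightarrow> bool" where
  "spread G S Z A \<longleftrightarrow> Z \<subseteq> carrier G \<and> S \<subseteq> carrier G \<and>
     (\<forall>g \<in> carrier G. \<forall>u \<in> Z. \<forall>v \<in> Z. g \<notin> A u \<longrightarrow> g \<notin> A v \<longrightarrow> u = v) \<and>
     (\<forall>s \<in> S. \<forall>u \<in> Z. \<forall>g \<in> carrier G \<inter> A u. \<forall>t \<in> S. \<forall>v \<in> Z. \<forall>h \<in> carrier G \<inter> A v.
        s \<otimes>\<^bsub>G\<^esub> (u \<otimes>\<^bsub>G\<^esub> g) = t \<otimes>\<^bsub>G\<^esub> (v \<otimes>\<^bsub>G\<^esub> h) \<longrightarrow> s = t \<and> u = v \<and> g = h)"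

lemma spread_inject:
  assumes "spread G S Z A" and "s \<in> S" "u \<in> Z" "g \<in> carrier G" "g \<in> A u"
    and "t \<in> S" "v \<in> Z" "h \<in> carrier G" "h \<in> A v"
    and "s \<otimes>\<^bsub>G\<^esub> (u \<otimes>\<^bsub>G\<^esub> g) = t \<otimes>\<^bsub>G\<^esub> (v \<otimes>\<^bsub>G\<^esub> h)"
  shows "s = t \<and> u = v \<and> g = h"
proof -
  have "\<forall>s \<in> S. \<forall>u \<in> Z. \<forall>g \<in> carrier G \<inter> A u. \<forall>t \<in> S. \<forall>v \<in> Z. \<forall>h \<in> carrier G \<inter> A v.
      s \<otimes>\<^bsub>G\<^esub> (u \<otimes>\<^bsub>G\<^esub> g) = t \<otimes>\<^bsub>G\<^esub> (v \<otimes>\<^bsub>G\<^esub> h) \<longrightarrow> s = t \<and> u = v \<and> g = h"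
    using assms(1) unfolding spread_def by (elim conjE)
  then show ?thesis using assms(2-10) by (meson IntI)
qed

lemma spread_miss:
  "\<lbrakk>spread G S Z A; g \<in> carrier G; u \<in> Z; v \<in> Z; g \<notin> A u; g \<notin> A v\<rbrakk> \<Longrightarrow> u = v"
  unfolding spread_def by (elim conjE) (drule (1) bspec, drule (1) bspec, drule (1) bspec, simp)

lemma spread_carrier: "spread G S Z A \<Longrightarrow> Z \<subseteq> carrier G"
  by (simp add: spread_def)

lemma successively_replicate: "P x x \<Longrightarrow> successively P (replicate n x)"
proof (induction n)
  case (Suc n) then show ?case by (cases n) auto
qed simp

text \<open>Both exponents equal the position of the first letter other than \<open>x\<close>. This
  reads off the lengths of the blocks in a word.\<close>

lemma replicate_Cons_eqD:
  assumes "replicate m x @ y # w = replicate n x @ z # v" and "y \<noteq> x" and "z \<noteq> x"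
  shows "m = n \<and> y = z \<and> w = v"
  using assms
proof (induction m arbitrary: n)
  case 0 then show ?case by (cases n) auto
next
  case (Suc m) then show ?case by (cases n) auto
qed

text \<open>If \<open>a\<close> were longer than \<open>b\<close>, the surplus of \<open>a\<close>
  would be nonempty and, by \<open>len\<close>, lie inside the block of \<open>j\<close> letters
  \<open>x\<close>, so \<open>a\<close> would end in \<open>x\<close>. Used in both directions, this
  shows that \<open>a\<close> and \<open>b\<close> have equal length although the blocks after them
  may differ.\<close>

lemma append_replicate_eqD:
  assumes eq: "a @ replicate i x @ w = b @ replicate j x @ v" and a: "a = [] \<or> last a \<noteq> x"
    and len: "length a \<le> length b + j"
  shows "length a \<le> length b"
proof (rule ccontr)
  assume "\<not> length a \<le> length b"
  moreover define c where "c = drop (length b) a"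
  moreover have "take (length b) a = b"
    using calculation(1) arg_cong[OF eq, of "take (length b)"] by simp
  ultimately have c: "a = b @ c" "c \<noteq> []"
    by (metis append_take_drop_id, simp)
  then have "c @ replicate i x @ w = replicate j x @ v" using eq by simp
  moreover have "length c \<le> j" using len c by simp
  ultimately have "c = replicate (length c) x"
    by (metis append_eq_append_conv_if length_replicate take_replicate min_absorb1)
  then have "last c = x" using c(2) by (metis last_replicate length_0_conv)
  then show False using a c by simp
qed

locale free_basis = group G for G :: "('g, 'b) monoid_scheme" (structure) +
  fixes B :: "'g set"
  assumes basis_subset: "B \<subseteq> carrier G"
    and basis_bij: "bij_betw (word_val G) (reduced_words B) (carrier G)"
begin

definition nf :: "'g \<Rightarrow> ('g \<times> bool) list" where
  "nf = inv_into (reduced_words B) (word_val G)"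

abbreviation no_cancel :: "'g \<times> bool \<Rightarrow> 'g \<times> bool \<Rightarrow> bool" where
  "no_cancel \<equiv> \<lambda>l m. \<not> (fst l = fst m \<and> snd l \<noteq> snd m)"

lemma nf_reduced: "g \<in> carrier G \<Longrightarrow> nf g \<in> reduced_words B"
  unfolding nf_def using basis_bij by (metis bij_betw_imp_surj_on inv_into_into)

lemma word_val_nf: "g \<in> carrier G \<Longrightarrow> word_val G (nf g) = g"
  unfolding nf_def using basis_bij by (metis bij_betw_inv_into_right)

lemma nf_word_val: "w \<in> reduced_words B \<Longrightarrow> nf (word_val G w) = w"
  unfolding nf_def using basis_bij by (metis bij_betw_inv_into_left)

lemma letter_val_closed: "fst l \<in> B \<Longrightarrow> letter_val G l \<in> carrier G"
  using basis_subset by (auto simp: letter_val_def)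

lemma word_val_closed: "w \<in> lists (B \<times> UNIV) \<Longrightarrow> word_val G w \<in> carrier G"
  by (induction w) (auto simp: word_val_def letter_val_closed)

lemma word_val_Nil [simp]: "word_val G [] = \<one>"
  by (simp add: word_val_def)

lemma word_val_Cons: "word_val G (l # w) = letter_val G l \<otimes> word_val G w"
  by (simp add: word_val_def)

lemma word_val_append:
  "w \<in> lists (B \<times> UNIV) \<Longrightarrow> v \<in> lists (B \<times> UNIV) \<Longrightarrow>
     word_val G (w @ v) = word_val G w \<otimes> word_val G v"
  by (induction w) (auto simp: word_val_Cons word_val_closed letter_val_closed m_assoc mem_Times_iff)

lemma word_val_replicate:
  "p \<in> B \<Longrightarrow> word_val G (replicate n (p, b)) = (if b then p [^] int n else p [^] - int n)"
proof (induction n)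
  case (Suc n)
  have p: "p \<in> carrier G" using Suc.prems basis_subset by auto
  have "p [^] int (Suc n) = p \<otimes> p [^] int n"
    using int_pow_mult[OF p, of 1 "int n"] p by simp
  moreover have "p [^] - int (Suc n) = inv p \<otimes> p [^] - int n"
    using int_pow_mult[OF p, of "-1" "- int n"] p by (simp add: int_pow_neg)
  ultimately show ?case using Suc by (simp add: word_val_Cons letter_val_def)
qed simp

lemma reduced_words_lists: "w \<in> reduced_words B \<Longrightarrow> w \<in> lists (B \<times> UNIV)"
  by (simp add: reduced_words_def)

lemma reduced_words_append:
  "w @ v \<in> reduced_words B \<longleftrightarrow> w \<in> reduced_words B \<and> v \<in> reduced_words B \<and>
     (w = [] \<or> v = [] \<or> no_cancel (last w) (hd v))"
  by (auto simp: reduced_words_def successively_append_iff)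

lemma reduced_words_Cons:
  "l # v \<in> reduced_words B \<longleftrightarrow> fst l \<in> B \<and> v \<in> reduced_words B \<and> (v = [] \<or> no_cancel l (hd v))"
  by (cases l) (auto simp: reduced_words_def successively_Cons)

lemma reduced_words_replicate: "fst l \<in> B \<Longrightarrow> replicate n l \<in> reduced_words B"
  by (cases l) (auto simp: reduced_words_def successively_replicate)

lemma word_val_inject:
  "\<lbrakk>word_val G w = word_val G v; w \<in> reduced_words B; v \<in> reduced_words B\<rbrakk> \<Longrightarrow> w = v"
  by (metis nf_word_val)

text \<open>Induction on the word from its right end: a final letter over \<open>p\<close> is
  absorbed into the exponent, any other final letter restarts with exponent 0. Multiplying by a
  large power of \<open>p\<close> then makes the exponent positive without touching
  \<open>a\<close>.\<close>

lemma strip_power: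
  assumes "g \<in> carrier G" and p: "p \<in> B"
  obtains a k where "a \<in> reduced_words B" "a = [] \<or> fst (last a) \<noteq> p"
    "g = word_val G a \<otimes> p [^] (k :: int)"
proof -
  have pc: "p \<in> carrier G" using p basis_subset by auto
  have "\<exists>a k. a \<in> reduced_words B \<and> (a = [] \<or> fst (last a) \<noteq> p) \<and>
      word_val G w = word_val G a \<otimes> p [^] (k :: int)" if "w \<in> reduced_words B" for w
    using that
  proof (induction w rule: rev_induct)
    case Nil
    then show ?case by (intro exI[of _ "[]"] exI[of _ 0]) auto
  next
    case (snoc l w)
    then have w: "w \<in> reduced_words B" and l: "fst l \<in> B"
      by (auto simp: reduced_words_append reduced_words_Cons)
    show ?case
    proof (cases "fst l = p")
      case True
      obtain a k where a: "a \<in> reduced_words B" "a = [] \<or> fst (last a) \<noteq> p"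
        "word_val G w = word_val G a \<otimes> p [^] (k :: int)" using snoc.IH w by blast
      have ac: "word_val G a \<in> carrier G" using a by (simp add: reduced_words_lists word_val_closed)
      have "letter_val G l = p [^] (if snd l then 1 else - 1 :: int)"
        using True pc by (auto simp: letter_val_def int_pow_neg)
      then have "word_val G (w @ [l]) = word_val G a \<otimes> p [^] (k + (if snd l then 1 else - 1))"
        using a ac w l pc
        by (subst word_val_append)
          (auto simp: reduced_words_lists word_val_Cons letter_val_closed m_assoc int_pow_mult
            mem_Times_iff)
      then show ?thesis using a by blast
    next
      case False
      then show ?thesis
        using snoc.prems by (intro exI[of _ "w @ [l]"] exI[of _ 0])
          (auto intro!: r_one[symmetric] word_val_closed dest: reduced_words_lists)
    qed
  qed
  from this[OF nf_reduced[OF assms(1)]] show ?thesis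
    using that word_val_nf[OF assms(1)] by metis
qed

text \<open>The elements are \<open>z\<^sub>n = p^L q^(n+1) p q^(n+1)\<close>. With \<open>L\<close> large compared with \<open>S\<close>, the prefix
  \<open>p^L q\<close> keeps the elements of \<open>S\<close> apart; an element \<open>g\<close> is bad for \<open>n\<close> if its reduced word begins
  with \<open>q^(-n-1) p^(-1)\<close>, which happens for at most one \<open>n\<close>.\<close>

lemma infinite_spread:
  assumes p: "p \<in> B" and q: "q \<in> B" and pq: "p \<noteq> q" and S: "finite S" "S \<subseteq> carrier G"
  shows "\<exists>Z A. infinite Z \<and> spread G S Z A"
proof -
  have "\<forall>s \<in> S. \<exists>a k. a \<in> reduced_words B \<and> (a = [] \<or> fst (last a) \<noteq> p) \<and>
      s = word_val G a \<otimes> p [^] (k :: int)"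
    using strip_power[OF _ p] S(2) by (metis subsetD)
  then obtain a k where a: "\<And>s. s \<in> S \<Longrightarrow> a s \<in> reduced_words B"
    "\<And>s. s \<in> S \<Longrightarrow> a s = [] \<or> fst (last (a s)) \<noteq> p"
    "\<And>s. s \<in> S \<Longrightarrow> s = word_val G (a s) \<otimes> p [^] (k s :: int)"
    by metis
  \<comment> \<open>\<open>L\<close> is chosen so large that every exponent \<open>L + k s\<close>
    exceeds the length of every \<open>a t\<close>. In particular these exponents are positive, and
    they supply the length hypothesis of \<open>append_replicate_eqD\<close>.\<close>
  have "finite ((\<lambda>(s, t). nat (int (length (a t)) - k s)) ` (S \<times> S))" using S(1) by simp
  then obtain L where "\<forall>x \<in> (\<lambda>(s, t). nat (int (length (a t)) - k s)) ` (S \<times> S). x < L"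
    unfolding finite_nat_set_iff_bounded by blast
  then have L: "int (length (a t)) < int L + k s" if "s \<in> S" "t \<in> S" for s t
    using that by force
  define P where "P = (p, True)"
  define Q where "Q = (q, True)"
  define e where "e s = nat (int L + k s)" for s
  define z where "z n = word_val G (replicate L P @ replicate (Suc n) Q @ P # replicate (Suc n) Q)" for n
  \<comment> \<open>\<open>y n g\<close> is the reduced word of what follows the inner letter
    \<open>p\<close> in \<open>z n \<otimes> g\<close>. Goodness says that this \<open>p\<close>
    does not cancel against it.\<close>
  define y where "y n g = nf (word_val G (replicate (Suc n) Q) \<otimes> g)" for n g
  define good where "good n g \<longleftrightarrow> g \<in> carrier G \<and> (y n g = [] \<or> hd (y n g) \<noteq> (p, False))" for n g
  have PQ: "fst P \<in> B" "fst Q \<in> B" "P \<noteq> Q" "no_cancel P Q" "no_cancel Q P" "P \<noteq> (p, False)"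
    using p q pq by (auto simp: P_def Q_def)
  have rl: "replicate n P \<in> lists (B \<times> UNIV)" "replicate n Q \<in> lists (B \<times> UNIV)" for n
    using PQ(1,2) by (auto simp: mem_Times_iff)
  have zred: "replicate L P @ replicate (Suc n) Q @ P # replicate (Suc n) Q \<in> reduced_words B" for n
    using PQ by (auto simp: reduced_words_append reduced_words_Cons reduced_words_replicate
        simp flip: replicate_Suc)
  have zc: "z n \<in> carrier G" for n
    unfolding z_def using zred reduced_words_lists word_val_closed by blast
  have qc: "word_val G (replicate n Q) \<in> carrier G" for n
    using rl word_val_closed by blast
  have yr: "y n g \<in> reduced_words B" "word_val G (y n g) = word_val G (replicate (Suc n) Q) \<otimes> g"
    if "g \<in> carrier G" for n g
    using that qc by (simp_all add: y_def nf_reduced word_val_nf del: replicate_Suc)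
  have zinj: "inj z"
  proof (rule injI)
    fix n m assume "z n = z m"
    then have "replicate L P @ replicate (Suc n) Q @ P # replicate (Suc n) Q =
       replicate L P @ replicate (Suc m) Q @ P # replicate (Suc m) Q"
      unfolding z_def by (rule word_val_inject[OF _ zred zred])
    then have "replicate (Suc n) Q @ P # replicate (Suc n) Q = replicate (Suc m) Q @ P # replicate (Suc m) Q"
      by (simp only: same_append_eq)
    from replicate_Cons_eqD[OF this] PQ(3) show "n = m" by auto
  qed
  \<comment> \<open>The powers of \<open>p\<close> at the end of \<open>s\<close> and at the start
    of \<open>z n\<close> merge into the exponent \<open>e s\<close>, and no seam of the resulting
    word cancels. Positivity of \<open>e s\<close> matters: without a letter \<open>p\<close> in
    between, \<open>a s\<close> could end in the inverse of \<open>q\<close> and cancel against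
    \<open>q\<close>.\<close>
  have word: "s \<otimes> (z n \<otimes> g) = word_val G (a s @ replicate (e s) P @ replicate (Suc n) Q @ P # y n g)"
    "a s @ replicate (e s) P @ replicate (Suc n) Q @ P # y n g \<in> reduced_words B"
    if s: "s \<in> S" and g: "good n g" for s n g
  proof -
    have gc: "g \<in> carrier G" using g by (simp add: good_def)
    have pc: "p \<in> carrier G" using p basis_subset by auto
    have ac: "word_val G (a s) \<in> carrier G" using a(1) s reduced_words_lists word_val_closed by blast
    have "0 < int L + k s" using L[OF s s] by simp
    then have "p [^] int (e s) = p [^] k s \<otimes> p [^] int L"
      using int_pow_mult[OF pc, of "k s" "int L"] by (simp add: e_def add.commute)
    then have pL: "p [^] k s \<otimes> (p [^] int L \<otimes> x) = p [^] int (e s) \<otimes> x" if "x \<in> carrier G" for x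
      using that pc by (simp add: m_assoc)
    have lP: "letter_val G P = p" using pc by (simp add: P_def letter_val_def)
    have rP: "word_val G (replicate i P) = p [^] int i" for i
      using p by (simp add: P_def word_val_replicate)
    define c where "c = word_val G (replicate (Suc n) Q)"
    have c: "c \<in> carrier G" unfolding c_def by (rule qc)
    have v2: "word_val G (replicate i P @ replicate (Suc n) Q @ P # w) =
        p [^] int i \<otimes> (c \<otimes> (p \<otimes> word_val G w))" if "w \<in> lists (B \<times> UNIV)" for i w
    proof -
      have w: "P # w \<in> lists (B \<times> UNIV)" "replicate (Suc n) Q @ P # w \<in> lists (B \<times> UNIV)"
        using that PQ(1,2) by (auto simp: mem_Times_iff)
      show ?thesis
        by (simp only: word_val_append[OF rl(1) w(2)] word_val_append[OF rl(2) w(1)]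
            word_val_Cons lP rP c_def)
    qed
    have z: "z n = p [^] int L \<otimes> (c \<otimes> (p \<otimes> c))"
      unfolding z_def v2[OF rl(2)] c_def ..
    have yl: "y n g \<in> lists (B \<times> UNIV)" "a s \<in> lists (B \<times> UNIV)"
      using yr(1)[OF gc] a(1)[OF s] reduced_words_lists by auto
    have "replicate (e s) P @ replicate (Suc n) Q @ P # y n g \<in> lists (B \<times> UNIV)"
      using yl(1) PQ(1,2) by (auto simp: mem_Times_iff)
    then have "word_val G (a s @ replicate (e s) P @ replicate (Suc n) Q @ P # y n g) =
        word_val G (a s) \<otimes> (p [^] int (e s) \<otimes> (c \<otimes> (p \<otimes> (c \<otimes> g))))"
      using word_val_append[OF yl(2)] v2[OF yl(1)] yr(2)[OF gc, of n]
      by (simp only: c_def)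
    also have "\<dots> = word_val G (a s) \<otimes> p [^] k s \<otimes> (z n \<otimes> g)"
      using ac pc gc c by (simp add: z m_assoc pL)
    finally show "s \<otimes> (z n \<otimes> g) =
        word_val G (a s @ replicate (e s) P @ replicate (Suc n) Q @ P # y n g)"
      using a(3)[OF s] by simp
    show "a s @ replicate (e s) P @ replicate (Suc n) Q @ P # y n g \<in> reduced_words B"
    proof -
      have y: "P # y n g \<in> reduced_words B"
        using yr(1)[OF gc, of n] g PQ(1) by (auto simp: reduced_words_Cons good_def P_def prod_eq_iff)
      then have "replicate (Suc n) Q @ P # y n g \<in> reduced_words B"
        using PQ by (simp add: reduced_words_append reduced_words_replicate del: replicate_Suc)
      then have "replicate (e s) P @ replicate (Suc n) Q @ P # y n g \<in> reduced_words B"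
        using PQ by (cases "e s = 0")
          (simp_all add: reduced_words_append[of "replicate (e s) P"] reduced_words_replicate)
      moreover obtain i where "e s = Suc i" using L[OF s s] by (cases "e s") (auto simp: e_def)
      ultimately show ?thesis
        using a(1,2)[OF s] by (auto simp: reduced_words_append[of "a s"] P_def)
    qed
  qed
  have bad: "n = m" if g: "g \<in> carrier G" "\<not> good n g" "\<not> good m g" for n m g
  proof -
    have "\<exists>v. nf g = replicate (Suc n) (q, False) @ (p, False) # v" if n: "\<not> good n g" for n
    proof -
      obtain v where v: "y n g = (p, False) # v"
        using n g(1) by (cases "y n g") (auto simp: good_def)
      \<comment> \<open>Moving the power of \<open>q\<close> back to \<open>g\<close> causes no
        cancellation, because \<open>y n g\<close> begins with the inverse of \<open>p\<close> and
        \<open>p \<noteq> q\<close>. So the length of the initial block of the reduced word of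
        \<open>g\<close> recovers \<open>n\<close>.\<close>
      let ?w = "replicate (Suc n) (q, False) @ y n g"
      have r: "?w \<in> reduced_words B"
        using yr(1)[OF g(1), of n] v p q
        by (simp add: reduced_words_append reduced_words_replicate del: replicate_Suc)
      have "word_val G ?w = word_val G (replicate (Suc n) (q, False)) \<otimes>
          (word_val G (replicate (Suc n) Q) \<otimes> g)"
        using yr[OF g(1), of n] q 
        by (subst word_val_append) (auto simp: reduced_words_lists mem_Times_iff simp del: replicate_Suc)
      also have "\<dots> = g"
        using q basis_subset g(1) 
        by (simp add: word_val_replicate Q_def m_assoc[symmetric] int_pow_neg subsetD l_inv del: replicate_Suc of_nat_Suc)
      finally show ?thesis using nf_word_val[OF r] v by auto
    qed
    from this[OF g(2)] this[OF g(3)] obtain v v' where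
      "replicate (Suc n) (q, False) @ (p, False) # v = replicate (Suc m) (q, False) @ (p, False) # v'"
      by metis
    from replicate_Cons_eqD[OF this] pq show "n = m" by simp
  qed
  \<comment> \<open>\<open>spread\<close> indexes the good sets by group elements; injectivity of
    \<open>z\<close> turns this back into an index \<open>n\<close>.\<close>
  define A where "A x = {g. \<exists>n. x = z n \<and> good n g}" for x
  have zA: "g \<in> A (z n) \<longleftrightarrow> good n g" for n g
    using zinj by (auto simp: A_def dest: injD)
  \<comment> \<open>The two reduced words coincide and are compared from left to right: first
    \<open>a s\<close> and \<open>a t\<close>, then the block of \<open>p\<close>, which gives
    \<open>k s = k t\<close>, then the block of \<open>q\<close>, which gives \<open>n = m\<close>,
    and finally the tails, which give \<open>g = h\<close>.\<close>
  have uniq: "s = t \<and> n = m \<and> g = h"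
    if st: "s \<in> S" "t \<in> S" and gh: "good n g" "good m h" and eq: "s \<otimes> (z n \<otimes> g) = t \<otimes> (z m \<otimes> h)"
    for s t n m g h
  proof -
    have w: "a s @ replicate (e s) P @ replicate (Suc n) Q @ P # y n g =
        a t @ replicate (e t) P @ replicate (Suc m) Q @ P # y m h"
      using word[OF st(1) gh(1)] word[OF st(2) gh(2)] eq word_val_inject by metis
    have lens: "length (a s) \<le> length (a t) + e t" "length (a t) \<le> length (a s) + e s"
      using L[OF st] L[OF st(2,1)] by (auto simp: e_def)
    have lasts: "a s = [] \<or> last (a s) \<noteq> P" "a t = [] \<or> last (a t) \<noteq> P"
      using a(2)[OF st(1)] a(2)[OF st(2)] by (auto simp: P_def)
    have "length (a s) = length (a t)"
      using append_replicate_eqD[OF w lasts(1) lens(1)] append_replicate_eqD[OF w[symmetric] lasts(2) lens(2)]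
      by simp
    \<comment> \<open>The exponent \<open>Suc n\<close> ensures a letter \<open>Q\<close> after the
      block of \<open>P\<close> even for \<open>n = 0\<close>; it marks where that block
      ends.\<close>
    then have as: "a s = a t" and r: "replicate (e s) P @ Q # replicate n Q @ P # y n g =
        replicate (e t) P @ Q # replicate m Q @ P # y m h"
      using w by auto
    have es: "e s = e t" and r: "replicate n Q @ P # y n g = replicate m Q @ P # y m h"
      using replicate_Cons_eqD[OF r] PQ(3) by auto
    have nm: "n = m" and yy: "y n g = y m h"
      using replicate_Cons_eqD[OF r] PQ(3) by auto
    have "k s = k t" using es L[OF st(1,1)] L[OF st(2,2)] by (auto simp: e_def)
    then have "s = t" using as a(3) st by metis
    moreover have gc: "g \<in> carrier G" "h \<in> carrier G" using gh by (auto simp: good_def)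
    then have "word_val G (replicate (Suc n) Q) \<otimes> g = word_val G (replicate (Suc n) Q) \<otimes> h"
      using yr(2)[of g n] yr(2)[of h n] yy nm by metis
    then have "g = h" using Units_l_cancel gc qc by (metis Units_eq)
    ultimately show ?thesis using nm by blast
  qed
  have "spread G S (range z) A"
    unfolding spread_def using S(2) zc
    by (auto simp: zA intro: arg_cong[of _ _ z] bad dest: uniq)
  moreover have "infinite (range z)" using zinj by (simp add: range_inj_infinite)
  ultimately show ?thesis by blast
qed

end

section \<open>The rank of a free group and its basis as a spread family\<close>

context free_basis
begin

text \<open>Such a group is trivial or cyclic: stripping the powers of the only basis element leaves
  the empty word. By contraposition, a nonabelian free group has two distinct basis
  elements.\<close>

lemma comm_groupI_basis:
  assumes "\<And>x y. x \<in> B \<Longrightarrow> y \<in> B \<Longrightarrow> x = y"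
  shows "comm_group G"
proof (cases "B = {}")
  case True
  then have "reduced_words B = {[]}" by (auto simp: reduced_words_def)
  then have "carrier G = {\<one>}" using basis_bij by (auto simp: bij_betw_def)
  then show ?thesis by (intro group_comm_groupI) auto
next
  case False
  then obtain p where p: "p \<in> B" by blast
  have pc: "p \<in> carrier G" using p basis_subset by blast
  have "\<exists>k::int. g = p [^] k" if g: "g \<in> carrier G" for g
  proof -
    obtain a k where a: "a \<in> reduced_words B" "a = [] \<or> fst (last a) \<noteq> p"
      "g = word_val G a \<otimes> p [^] (k :: int)" using strip_power[OF g p] .
    have "a = []"
    proof (rule ccontr)
      assume "a \<noteq> []"
      then have "fst (last a) \<in> B" using reduced_words_lists[OF a(1)] last_in_set[of a] by fastforce
      then show False using a(2) \<open>a \<noteq> []\<close> assms p by blast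
    qed
    then show ?thesis using a(3) pc by auto
  qed
  then show ?thesis
    using pc by (intro group_comm_groupI) (metis add.commute int_pow_mult)
qed

text \<open>For \<open>g \<in> A u\<close>, putting the letter \<open>u\<close> in front of the
  reduced word of \<open>g\<close> gives the reduced word of \<open>u \<otimes> g\<close>, whose
  first letter and tail recover \<open>u\<close> and \<open>g\<close>. An element outside
  \<open>A u\<close> begins with the inverse of \<open>u\<close>, which determines
  \<open>u\<close>.\<close>

lemma basis_spread: "\<exists>A. spread G {\<one>} B A"
proof -
  define A where "A u = {g. nf g = [] \<or> hd (nf g) \<noteq> (u, False)}" for u
  have nf: "nf (u \<otimes> g) = (u, True) # nf g" if "u \<in> B" "g \<in> A u" "g \<in> carrier G" for u g
  proof -
    have "word_val G ((u, True) # nf g) = u \<otimes> g"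
      using that by (simp add: word_val_Cons letter_val_def word_val_nf)
    moreover have "(u, True) # nf g \<in> reduced_words B"
      using that nf_reduced[OF that(3)] by (auto simp: reduced_words_Cons A_def prod_eq_iff)
    ultimately show ?thesis by (metis nf_word_val)
  qed
  have "spread G {\<one>} B A"
    unfolding spread_def
  proof (intro conjI ballI impI)
    fix g u v assume "g \<notin> A u" "g \<notin> A v"
    then show "u = v" by (simp add: A_def)
  next
    fix s u g t v h
    assume *: "s \<in> {\<one>}" "u \<in> B" "g \<in> carrier G \<inter> A u" "t \<in> {\<one>}" "v \<in> B"
      "h \<in> carrier G \<inter> A v" "s \<otimes> (u \<otimes> g) = t \<otimes> (v \<otimes> h)"
    then have "u \<otimes> g = v \<otimes> h" using basis_subset by (auto simp: subset_iff)
    then have eq: "(u, True) # nf g = (v, True) # nf h" using * nf by (metis IntD1 IntD2)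
    then have "g = h" using * word_val_nf by (metis IntD1 list.inject)
    then show "s = t" "u = v" "g = h" using * eq by auto
  qed (use basis_subset in auto)
  then show ?thesis by blast
qed

end

lemma free_group_iff_basis: "free_group G \<longleftrightarrow> (\<exists>B. free_basis G B)"
  by (auto simp: free_group_def free_basis_def free_basis_axioms_def)

section \<open>Locally free groups\<close>

text \<open>Dividing \<open>g\<close> on the right by a chosen representative of the coset
  \<open>H #> g\<close> gives an element of \<open>H\<close> and commutes with left multiplication
  by \<open>H\<close>. The map carries conditions on reduced words in \<open>H\<close> over to all
  of \<open>G\<close>.\<close>

lemma (in group) subgroup_equivariant_map:
  assumes "subgroup H G"
  obtains \<phi> where "\<And>g. g \<in> carrier G \<Longrightarrow> \<phi> g \<in> H"
    "\<And>h g. h \<in> H \<Longrightarrow> g \<in> carrier G \<Longrightarrow> \<phi> (h \<otimes> g) = h \<otimes> \<phi> g"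
proof -
  interpret H: subgroup H G by fact
  \<comment> \<open>The choice depends on \<open>g\<close> only through its coset, so
    \<open>c\<close> is constant on cosets; equivariance rests on this.\<close>
  define c where "c g = (SOME x. x \<in> H #> g)" for g
  have c: "c g \<in> H #> g" if "g \<in> carrier G" for g
    unfolding c_def using rcos_self[OF that assms] by (rule someI)
  then have cc: "c g \<in> carrier G" if "g \<in> carrier G" for g
    using that H.subset r_coset_subset_G by blast
  define \<phi> where "\<phi> g = g \<otimes> inv c g" for g
  show thesis
  proof
    fix g assume g: "g \<in> carrier G"
    obtain h where h: "h \<in> H" "c g = h \<otimes> g" using c[OF g] by (auto simp: r_coset_def)
    then have "\<phi> g = inv h"
      using g by (simp add: \<phi>_def inv_mult_group m_assoc[symmetric])
    then show "\<phi> g \<in> H" using h by simp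
  next
    fix h g assume h: "h \<in> H" and g: "g \<in> carrier G"
    have "H #> (h \<otimes> g) = H #> g"
      using coset_mult_assoc[OF H.subset, of h g] H.rcos_const[OF is_group h] h g by simp
    then have "c (h \<otimes> g) = c g" by (simp add: c_def)
    then show "\<phi> (h \<otimes> g) = h \<otimes> \<phi> g" using h g cc by (simp add: \<phi>_def m_assoc)
  qed
qed

text \<open>The sets \<open>A u\<close> are pulled back along the equivariant map. Applying the map
  to an equation between products gives one in \<open>H\<close>, hence \<open>s = t\<close> and
  \<open>u = v\<close>. The map identifies elements of different cosets, so \<open>g = h\<close>
  comes from cancelling in \<open>G\<close> instead.\<close>

lemma (in group) spread_subgroup:
  assumes H: "subgroup H G" and sp: "spread (G\<lparr>carrier := H\<rparr>) S Z A"
  shows "\<exists>A. spread G S Z A"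
proof -
  interpret H: subgroup H G by fact
  obtain \<phi> where \<phi>: "\<And>g. g \<in> carrier G \<Longrightarrow> \<phi> g \<in> H"
    "\<And>h g. h \<in> H \<Longrightarrow> g \<in> carrier G \<Longrightarrow> \<phi> (h \<otimes> g) = h \<otimes> \<phi> g"
    using subgroup_equivariant_map[OF H] by blast
  have ZS: "Z \<subseteq> H" "S \<subseteq> H" using sp by (auto simp: spread_def)
  have uq: "u = v" if "x \<in> H" "u \<in> Z" "v \<in> Z" "x \<notin> A u" "x \<notin> A v" for x u v
    using sp that unfolding spread_def by simp
  have inj: "s = t \<and> u = v \<and> x = y" if "s \<in> S" "u \<in> Z" "x \<in> H" "x \<in> A u" "t \<in> S" "v \<in> Z" "y \<in> H" "y \<in> A v"
      "s \<otimes> (u \<otimes> x) = t \<otimes> (v \<otimes> y)" for s u x t v y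
    using sp that by (auto simp: spread_def)
  have "spread G S Z (\<lambda>u. {g. \<phi> g \<in> A u})"
    unfolding spread_def
  proof (intro conjI ballI impI)
    fix g u v assume "g \<in> carrier G" "u \<in> Z" "v \<in> Z" "g \<notin> {g. \<phi> g \<in> A u}" "g \<notin> {g. \<phi> g \<in> A v}"
    then show "u = v" using uq[of "\<phi> g" u v] \<phi>(1) by blast
  next
    fix s u g t v h
    assume *: "s \<in> S" "u \<in> Z" "g \<in> carrier G \<inter> {g. \<phi> g \<in> A u}" "t \<in> S" "v \<in> Z"
      "h \<in> carrier G \<inter> {g. \<phi> g \<in> A v}" "s \<otimes> (u \<otimes> g) = t \<otimes> (v \<otimes> h)"
    have m: "s \<in> H" "u \<in> H" "t \<in> H" "v \<in> H" using * ZS by auto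
    have "\<phi> (s \<otimes> (u \<otimes> g)) = \<phi> (t \<otimes> (v \<otimes> h))" using * by simp
    moreover have "\<phi> (s \<otimes> (u \<otimes> g)) = s \<otimes> (u \<otimes> \<phi> g)"
      "\<phi> (t \<otimes> (v \<otimes> h)) = t \<otimes> (v \<otimes> \<phi> h)"
      using *(3,6) m H.mem_carrier by (auto simp: \<phi>(2) simp del: *(7))
    ultimately have "s \<otimes> (u \<otimes> \<phi> g) = t \<otimes> (v \<otimes> \<phi> h)" by simp
    then have st: "s = t \<and> u = v" using inj[of s u "\<phi> g" t v "\<phi> h"] * \<phi>(1) by blast
    then show "s = t" "u = v" by auto
    have "s \<otimes> (u \<otimes> g) = s \<otimes> (u \<otimes> h)" using *(7) st by simp
    then show "g = h" using *(3,6) m H.mem_carrier by simp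
  qed (use ZS H.subset in auto)
  then show ?thesis by blast
qed

text \<open>Adjoining a noncommuting pair to \<open>S\<close> makes the finitely generated subgroup
  nonabelian. It is free, so its basis has two distinct elements, and the construction in that
  subgroup extends to \<open>G\<close>.\<close>

lemma (in group) locally_free_infinite_spread:
  assumes nc: "\<not> comm_group G" and lf: "locally_free_group G" and S: "finite S" "S \<subseteq> carrier G"
  shows "\<exists>Z A. infinite Z \<and> spread G S Z A"
proof -
  obtain c d where cd: "c \<in> carrier G" "d \<in> carrier G" "c \<otimes> d \<noteq> d \<otimes> c"
    using nc group_comm_groupI by blast
  let ?T = "S \<union> {c, d}"
  have T: "finite ?T" "?T \<subseteq> carrier G" using S cd by auto
  define H where "H = generate G ?T"
  have H: "subgroup H G" unfolding H_def using T(2) by (rule generate_is_subgroup)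
  have TH: "?T \<subseteq> H" unfolding H_def by (auto intro: generate.incl)
  have "free_group (G\<lparr>carrier := H\<rparr>)" using lf T unfolding locally_free_group_def H_def by blast
  then obtain B where "free_basis (G\<lparr>carrier := H\<rparr>) B" by (auto simp: free_group_iff_basis)
  then interpret F: free_basis "G\<lparr>carrier := H\<rparr>" B .
  have "\<not> comm_group (G\<lparr>carrier := H\<rparr>)"
  proof
    assume "comm_group (G\<lparr>carrier := H\<rparr>)"
    then interpret C: comm_group "G\<lparr>carrier := H\<rparr>" .
    show False using C.m_comm[of c d] cd TH by auto
  qed
  then obtain p q where "p \<in> B" "q \<in> B" "p \<noteq> q" using F.comm_groupI_basis by blast
  then show ?thesis
    using F.infinite_spread[of p q S] S(1) TH spread_subgroup[OF H] by fastforce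
qed

section \<open>Cardinal arithmetic of infinite sets\<close>

lemma lepoll_iff_ordLeq: "A \<lesssim> B \<longleftrightarrow> |A| \<le>o |B|"
  by (auto simp: lepoll_def card_of_ordLeq)

lemma lists_lepoll_infinite:
  assumes "infinite A" shows "lists A \<lesssim> A"
  using card_of_lists_infinite[OF assms] by (simp add: lepoll_iff_ordLeq ordIso_iff_ordLeq)

lemma times_lepoll_infinite:
  assumes "infinite C" "A \<lesssim> C" "B \<lesssim> C" shows "A \<times> B \<lesssim> C"
proof -
  have "A \<times> B \<lesssim> C \<times> C" using assms(2,3) by (rule times_lepoll_mono)
  also have "C \<times> C \<lesssim> C"
    using card_of_Times_same_infinite[OF assms(1)] by (simp add: lepoll_iff_ordLeq ordIso_iff_ordLeq)
  finally show ?thesis .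
qed

lemma countable_lepoll_infinite:
  assumes "countable A" "infinite B" shows "A \<lesssim> B"
proof -
  have "A \<lesssim> (UNIV :: nat set)"
    using inj_on_to_nat_on[OF assms(1)] by (auto simp: lepoll_def)
  also have "(UNIV :: nat set) \<lesssim> B" using assms(2) by (simp add: infinite_le_lepoll)
  finally show ?thesis .
qed

text \<open>If the basis of \<open>H\<close> is infinite, it has as many elements as there are words
  in it, so at least as many as \<open>G\<close>, and serves as \<open>Z\<close>. If it is finite,
  \<open>G\<close> is countable and any infinite spread family is large enough. In that case
  \<open>H\<close> may be cyclic, so the family comes from a nonabelian finitely generated subgroup
  rather than from \<open>H\<close>.\<close>

lemma (in group) locally_free_large_spread:
  assumes nc: "\<not> comm_group G" and lf: "locally_free_group G"
    and H: "subgroup H G" "free_group (G\<lparr>carrier := H\<rparr>)" "H \<approx> carrier G"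
  shows "\<exists>Z A. carrier G \<lesssim> Z \<and> spread G {\<one>} Z A"
proof -
  obtain B where "free_basis (G\<lparr>carrier := H\<rparr>) B" using H(2) by (auto simp: free_group_iff_basis)
  then interpret F: free_basis "G\<lparr>carrier := H\<rparr>" B .
  have GB: "carrier G \<lesssim> lists (B \<times> (UNIV :: bool set))"
  proof -
    have "carrier G \<approx> H" using H(3) by (rule eqpoll_sym)
    also have "H \<approx> reduced_words B" using F.basis_bij eqpoll_sym by (auto simp: eqpoll_def)
    also have "reduced_words B \<lesssim> lists (B \<times> (UNIV :: bool set))"
      by (intro subset_imp_lepoll) (auto simp: reduced_words_def)
    finally show ?thesis .
  qed
  show ?thesis
  proof (cases "finite B")
    case False
    have "B \<times> (UNIV :: bool set) \<lesssim> B"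
      using False by (intro times_lepoll_infinite) (auto intro: countable_lepoll_infinite)
    then have "lists (B \<times> (UNIV :: bool set)) \<lesssim> lists B" by (rule lists_lepoll_mono)
    then have "carrier G \<lesssim> B"
      using lists_lepoll_infinite[OF False] by (rule lepoll_trans[OF GB lepoll_trans])
    moreover obtain A where "spread (G\<lparr>carrier := H\<rparr>) {\<one>} B A" using F.basis_spread by auto
    ultimately show ?thesis using spread_subgroup[OF H(1)] by blast
  next
    case True
    then have "countable (lists (B \<times> (UNIV :: bool set)))"
      by (intro countable_lists countable_SIGMA) (auto intro: countable_finite)
    then have "countable (carrier G)" using GB by (meson countable_lepoll)
    moreover obtain Z A where "infinite Z" "spread G {\<one>} Z A"
      using locally_free_infinite_spread[OF nc lf, of "{\<one>}"] by auto
    ultimately show ?thesis using countable_lepoll_infinite by blast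
  qed
qed

lemma Fpow_lepoll_infinite:
  assumes "infinite A" shows "Fpow A \<lesssim> A"
  using card_of_Fpow_infinite[OF assms] by (simp add: lepoll_iff_ordLeq ordIso_iff_ordLeq)

section \<open>Finite sums\<close>

lemma (in abelian_monoid) finsum_eq_single:
  assumes "finite A" "a \<in> A" "f a \<in> carrier G" "\<And>x. x \<in> A \<Longrightarrow> x \<noteq> a \<Longrightarrow> f x = \<zero>"
  shows "finsum G f A = f a"
proof -
  have "f x \<in> carrier G" if "x \<in> A" for x
    using assms that by (cases "x = a") auto
  then have "finsum G f A = finsum G f {a}"
    using assms by (intro add.finprod_mono_neutral_cong_right) auto
  then show ?thesis using assms(3) by simp
qed

lemma (in abelian_monoid) finsum_swap:
  assumes "finite A" "finite B" "\<And>x y. x \<in> A \<Longrightarrow> y \<in> B \<Longrightarrow> f x y \<in> carrier G"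
  shows "(\<Oplus>x\<in>A. \<Oplus>y\<in>B. f x y) = (\<Oplus>y\<in>B. \<Oplus>x\<in>A. f x y)"
  using assms(1,3)
proof (induction A)
  case (insert a A)
  then have "(\<Oplus>x\<in>insert a A. \<Oplus>y\<in>B. f x y) = (\<Oplus>y\<in>B. f a y) \<oplus> (\<Oplus>y\<in>B. \<Oplus>x\<in>A. f x y)"
    by (auto simp: Pi_iff intro!: finsum_closed)
  also have "\<dots> = (\<Oplus>y\<in>B. f a y \<oplus> (\<Oplus>x\<in>A. f x y))"
    using insert.prems by (intro finsum_addf[symmetric]) (auto simp: Pi_iff intro!: finsum_closed)
  also have "\<dots> = (\<Oplus>y\<in>B. \<Oplus>x\<in>insert a A. f x y)"
    using insert by (intro finsum_cong') (auto simp: Pi_iff intro!: finsum_closed)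
  finally show ?case .
qed (simp add: finsum_zero)

section \<open>Group rings\<close>

locale group_ring_context = R: ring R + G: group G
  for R :: "('r, 'a) ring_scheme" and G :: "('g, 'b) monoid_scheme"
begin

abbreviation RG :: "('g \<Rightarrow> 'r) ring" where "RG \<equiv> group_ring R G"

definition supp :: "('g \<Rightarrow> 'r) \<Rightarrow> 'g set" where
  "supp f = {x \<in> carrier G. f x \<noteq> \<zero>\<^bsub>R\<^esub>}"

lemma carrier_RG:
  "f \<in> carrier RG \<longleftrightarrow> (\<forall>x. f x \<in> carrier R) \<and> (\<forall>x. x \<notin> carrier G \<longrightarrow> f x = \<zero>\<^bsub>R\<^esub>) \<and> finite (supp f)"
proof -
  have "f x \<in> carrier R" if "\<forall>x \<in> carrier G. f x \<in> carrier R" "\<forall>x. x \<notin> carrier G \<longrightarrow> f x = \<zero>\<^bsub>R\<^esub>" for x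
    using that by (cases "x \<in> carrier G") auto
  then show ?thesis unfolding group_ring_def supp_def by simp blast
qed

lemma zero_RG: "\<zero>\<^bsub>RG\<^esub> = (\<lambda>x. \<zero>\<^bsub>R\<^esub>)"
  and one_RG: "\<one>\<^bsub>RG\<^esub> = (\<lambda>x. if x = \<one>\<^bsub>G\<^esub> then \<one>\<^bsub>R\<^esub> else \<zero>\<^bsub>R\<^esub>)"
  and add_RG: "f \<oplus>\<^bsub>RG\<^esub> h = (\<lambda>x. f x \<oplus>\<^bsub>R\<^esub> h x)"
  by (simp_all add: group_ring_def)

lemma RG_closed: "f \<in> carrier RG \<Longrightarrow> f x \<in> carrier R"
  and RG_outside: "f \<in> carrier RG \<Longrightarrow> x \<notin> carrier G \<Longrightarrow> f x = \<zero>\<^bsub>R\<^esub>"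
  and finite_supp: "f \<in> carrier RG \<Longrightarrow> finite (supp f)"
  by (auto simp: carrier_RG)

lemma supp_subset: "supp f \<subseteq> carrier G"
  by (auto simp: supp_def)

lemma not_supp: "f \<in> carrier RG \<Longrightarrow> x \<notin> supp f \<Longrightarrow> f x = \<zero>\<^bsub>R\<^esub>"
  by (auto simp: supp_def carrier_RG)

lemma supp_empty_iff: "f \<in> carrier RG \<Longrightarrow> supp f = {} \<longleftrightarrow> f = \<zero>\<^bsub>RG\<^esub>"
  by (auto simp: supp_def carrier_RG zero_RG fun_eq_iff)

lemma mult_RG_outside: "x \<notin> carrier G \<Longrightarrow> (f \<otimes>\<^bsub>RG\<^esub> h) x = \<zero>\<^bsub>R\<^esub>"
  by (simp add: group_ring_def)

text \<open>Terms outside the support of \<open>f\<close> vanish, so any finite superset may index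
  the convolution. This gives different products a common range of summation.\<close>

lemma mult_RG:
  assumes f: "f \<in> carrier RG" and h: "h \<in> carrier RG" and x: "x \<in> carrier G"
    and A: "finite A" "supp f \<subseteq> A"
  shows "(f \<otimes>\<^bsub>RG\<^esub> h) x = (\<Oplus>\<^bsub>R\<^esub>y\<in>A. f y \<otimes>\<^bsub>R\<^esub> h (inv\<^bsub>G\<^esub> y \<otimes>\<^bsub>G\<^esub> x))"
proof -
  have "(f \<otimes>\<^bsub>RG\<^esub> h) x = (\<Oplus>\<^bsub>R\<^esub>y\<in>supp f. f y \<otimes>\<^bsub>R\<^esub> h (inv\<^bsub>G\<^esub> y \<otimes>\<^bsub>G\<^esub> x))"
    using x by (simp add: group_ring_def supp_def)
  also have "\<dots> = (\<Oplus>\<^bsub>R\<^esub>y\<in>A. f y \<otimes>\<^bsub>R\<^esub> h (inv\<^bsub>G\<^esub> y \<otimes>\<^bsub>G\<^esub> x))"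
    using A not_supp[OF f] RG_closed[OF f] RG_closed[OF h]
    by (intro R.add.finprod_mono_neutral_cong_left) auto
  finally show ?thesis .
qed

lemma supp_mult_subset:
  assumes f: "f \<in> carrier RG" and h: "h \<in> carrier RG"
  shows "supp (f \<otimes>\<^bsub>RG\<^esub> h) \<subseteq> (\<lambda>(y, z). y \<otimes>\<^bsub>G\<^esub> z) ` (supp f \<times> supp h)"
proof
  fix x assume x: "x \<in> supp (f \<otimes>\<^bsub>RG\<^esub> h)"
  then have xc: "x \<in> carrier G" by (simp add: supp_def)
  have "\<exists>y\<in>supp f. f y \<otimes>\<^bsub>R\<^esub> h (inv\<^bsub>G\<^esub> y \<otimes>\<^bsub>G\<^esub> x) \<noteq> \<zero>\<^bsub>R\<^esub>"
  proof (rule ccontr)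
    assume "\<not> ?thesis"
    then have "(f \<otimes>\<^bsub>RG\<^esub> h) x = (\<Oplus>\<^bsub>R\<^esub>y\<in>supp f. \<zero>\<^bsub>R\<^esub>)"
      unfolding mult_RG[OF f h xc finite_supp[OF f] subset_refl] by (intro R.finsum_cong') auto
    then show False using x by (simp add: R.finsum_zero supp_def)
  qed
  then obtain y where y: "y \<in> supp f" "f y \<otimes>\<^bsub>R\<^esub> h (inv\<^bsub>G\<^esub> y \<otimes>\<^bsub>G\<^esub> x) \<noteq> \<zero>\<^bsub>R\<^esub>" by blast
  then have "h (inv\<^bsub>G\<^esub> y \<otimes>\<^bsub>G\<^esub> x) \<noteq> \<zero>\<^bsub>R\<^esub>" using RG_closed[OF f] by auto
  moreover have yc: "y \<in> carrier G" using y(1) supp_subset by auto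
  ultimately have "inv\<^bsub>G\<^esub> y \<otimes>\<^bsub>G\<^esub> x \<in> supp h" using xc by (simp add: supp_def)
  moreover have "x = y \<otimes>\<^bsub>G\<^esub> (inv\<^bsub>G\<^esub> y \<otimes>\<^bsub>G\<^esub> x)" using xc yc by (simp flip: G.m_assoc)
  ultimately show "x \<in> (\<lambda>(y, z). y \<otimes>\<^bsub>G\<^esub> z) ` (supp f \<times> supp h)" using y(1) by force
qed

lemma mult_RG_closed:
  assumes f: "f \<in> carrier RG" and h: "h \<in> carrier RG"
  shows "f \<otimes>\<^bsub>RG\<^esub> h \<in> carrier RG"
proof -
  have "(f \<otimes>\<^bsub>RG\<^esub> h) x \<in> carrier R" for x
    using mult_RG[OF f h _ finite_supp[OF f] subset_refl] mult_RG_outside RG_closed f h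
    by (cases "x \<in> carrier G") (auto intro!: R.finsum_closed)
  moreover have "finite (supp (f \<otimes>\<^bsub>RG\<^esub> h))"
    using supp_mult_subset[OF f h] finite_supp[OF f] finite_supp[OF h]
    by (meson finite_SigmaI finite_imageI finite_subset)
  ultimately show ?thesis by (simp add: carrier_RG mult_RG_outside)
qed

lemma add_RG_closed:
  assumes f: "f \<in> carrier RG" and h: "h \<in> carrier RG"
  shows "f \<oplus>\<^bsub>RG\<^esub> h \<in> carrier RG"
proof -
  have "supp (f \<oplus>\<^bsub>RG\<^esub> h) \<subseteq> supp f \<union> supp h" by (auto simp: supp_def add_RG)
  then have "finite (supp (f \<oplus>\<^bsub>RG\<^esub> h))"
    using finite_supp[OF f] finite_supp[OF h] finite_subset by blast
  then show ?thesis using f h by (simp add: carrier_RG add_RG)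
qed

text \<open>Both sides become the sum of \<open>f y\<close>, \<open>g (inv y z)\<close>,
  \<open>h (inv z x)\<close> over \<open>y\<close> in the support of \<open>f\<close> and
  \<open>z\<close> in the product of the supports of \<open>f\<close> and \<open>g\<close>. On the
  right this needs the substitution of \<open>inv y z\<close> for the inner variable.\<close>

lemma mult_RG_assoc:
  assumes f: "f \<in> carrier RG" and g: "g \<in> carrier RG" and h: "h \<in> carrier RG"
  shows "f \<otimes>\<^bsub>RG\<^esub> g \<otimes>\<^bsub>RG\<^esub> h = f \<otimes>\<^bsub>RG\<^esub> (g \<otimes>\<^bsub>RG\<^esub> h)"
proof
  fix x
  let ?A = "supp f"
  let ?C = "(\<lambda>(y, z). y \<otimes>\<^bsub>G\<^esub> z) ` (supp f \<times> supp g)"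
  note cl [simp] = RG_closed[OF f] RG_closed[OF g] RG_closed[OF h]
  show "(f \<otimes>\<^bsub>RG\<^esub> g \<otimes>\<^bsub>RG\<^esub> h) x = (f \<otimes>\<^bsub>RG\<^esub> (g \<otimes>\<^bsub>RG\<^esub> h)) x"
  proof (cases "x \<in> carrier G")
    case x: True
    have fin: "finite ?A" "finite ?C" using finite_supp f g by auto
    have Cc: "z \<in> carrier G" if "z \<in> ?C" for z using that supp_subset by fastforce
    have Ac: "y \<in> carrier G" if "y \<in> ?A" for y using that supp_subset by blast
    have "(f \<otimes>\<^bsub>RG\<^esub> g \<otimes>\<^bsub>RG\<^esub> h) x = (\<Oplus>\<^bsub>R\<^esub>z\<in>?C. (f \<otimes>\<^bsub>RG\<^esub> g) z \<otimes>\<^bsub>R\<^esub> h (inv\<^bsub>G\<^esub> z \<otimes>\<^bsub>G\<^esub> x))"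
      using f g h x fin(2) supp_mult_subset[OF f g] by (intro mult_RG mult_RG_closed)
    also have "\<dots> = (\<Oplus>\<^bsub>R\<^esub>z\<in>?C. \<Oplus>\<^bsub>R\<^esub>y\<in>?A. f y \<otimes>\<^bsub>R\<^esub> g (inv\<^bsub>G\<^esub> y \<otimes>\<^bsub>G\<^esub> z) \<otimes>\<^bsub>R\<^esub> h (inv\<^bsub>G\<^esub> z \<otimes>\<^bsub>G\<^esub> x))"
      using fin(1) mult_RG[OF f g Cc fin(1) subset_refl]
      by (intro R.finsum_cong') (auto intro!: R.finsum_closed R.finsum_ldistr)
    also have "\<dots> = (\<Oplus>\<^bsub>R\<^esub>y\<in>?A. \<Oplus>\<^bsub>R\<^esub>z\<in>?C. f y \<otimes>\<^bsub>R\<^esub> g (inv\<^bsub>G\<^esub> y \<otimes>\<^bsub>G\<^esub> z) \<otimes>\<^bsub>R\<^esub> h (inv\<^bsub>G\<^esub> z \<otimes>\<^bsub>G\<^esub> x))"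
      using fin by (intro R.finsum_swap) auto
    also have "\<dots> = (\<Oplus>\<^bsub>R\<^esub>y\<in>?A. f y \<otimes>\<^bsub>R\<^esub> (g \<otimes>\<^bsub>RG\<^esub> h) (inv\<^bsub>G\<^esub> y \<otimes>\<^bsub>G\<^esub> x))"
    proof (intro R.finsum_cong' refl)
      fix y assume y: "y \<in> ?A"
      let ?t = "\<lambda>w. g w \<otimes>\<^bsub>R\<^esub> h (inv\<^bsub>G\<^esub> w \<otimes>\<^bsub>G\<^esub> (inv\<^bsub>G\<^esub> y \<otimes>\<^bsub>G\<^esub> x))"
      have yc: "y \<in> carrier G" using Ac y .
      \<comment> \<open>The translate of \<open>?C\<close> contains the support of \<open>g\<close>,
        so it may serve as the range of the inner convolution.\<close>
      have sub: "supp g \<subseteq> (\<lambda>z. inv\<^bsub>G\<^esub> y \<otimes>\<^bsub>G\<^esub> z) ` ?C"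
      proof
        fix w assume w: "w \<in> supp g"
        then have "w \<in> carrier G" using supp_subset by blast
        then have "w = inv\<^bsub>G\<^esub> y \<otimes>\<^bsub>G\<^esub> (y \<otimes>\<^bsub>G\<^esub> w)" using yc by (simp flip: G.m_assoc)
        then show "w \<in> (\<lambda>z. inv\<^bsub>G\<^esub> y \<otimes>\<^bsub>G\<^esub> z) ` ?C" using y w by force
      qed
      have "(g \<otimes>\<^bsub>RG\<^esub> h) (inv\<^bsub>G\<^esub> y \<otimes>\<^bsub>G\<^esub> x) = (\<Oplus>\<^bsub>R\<^esub>w\<in>(\<lambda>z. inv\<^bsub>G\<^esub> y \<otimes>\<^bsub>G\<^esub> z) ` ?C. ?t w)"
        using fin x yc sub by (intro mult_RG[OF g h]) auto
      also have "\<dots> = (\<Oplus>\<^bsub>R\<^esub>z\<in>?C. ?t (inv\<^bsub>G\<^esub> y \<otimes>\<^bsub>G\<^esub> z))"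
      proof (rule R.finsum_reindex)
        show "inj_on (\<lambda>z. inv\<^bsub>G\<^esub> y \<otimes>\<^bsub>G\<^esub> z) ?C"
          using yc Cc by (intro inj_onI) (metis G.Units_eq G.Units_l_cancel G.inv_closed)
      qed auto
      also have "\<dots> = (\<Oplus>\<^bsub>R\<^esub>z\<in>?C. g (inv\<^bsub>G\<^esub> y \<otimes>\<^bsub>G\<^esub> z) \<otimes>\<^bsub>R\<^esub> h (inv\<^bsub>G\<^esub> z \<otimes>\<^bsub>G\<^esub> x))"
      proof (intro R.finsum_cong' refl)
        fix z assume "z \<in> ?C"
        then have zc: "z \<in> carrier G" by (rule Cc)
        have "inv\<^bsub>G\<^esub> (inv\<^bsub>G\<^esub> y \<otimes>\<^bsub>G\<^esub> z) \<otimes>\<^bsub>G\<^esub> (inv\<^bsub>G\<^esub> y \<otimes>\<^bsub>G\<^esub> x) = inv\<^bsub>G\<^esub> z \<otimes>\<^bsub>G\<^esub> (y \<otimes>\<^bsub>G\<^esub> (inv\<^bsub>G\<^esub> y \<otimes>\<^bsub>G\<^esub> x))"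
          using yc zc x by (simp add: G.inv_mult_group G.m_assoc)
        also have "\<dots> = inv\<^bsub>G\<^esub> z \<otimes>\<^bsub>G\<^esub> x" using yc x by (simp flip: G.m_assoc)
        finally show "?t (inv\<^bsub>G\<^esub> y \<otimes>\<^bsub>G\<^esub> z) = g (inv\<^bsub>G\<^esub> y \<otimes>\<^bsub>G\<^esub> z) \<otimes>\<^bsub>R\<^esub> h (inv\<^bsub>G\<^esub> z \<otimes>\<^bsub>G\<^esub> x)" by simp
      qed auto
      finally show "(\<Oplus>\<^bsub>R\<^esub>z\<in>?C. f y \<otimes>\<^bsub>R\<^esub> g (inv\<^bsub>G\<^esub> y \<otimes>\<^bsub>G\<^esub> z) \<otimes>\<^bsub>R\<^esub> h (inv\<^bsub>G\<^esub> z \<otimes>\<^bsub>G\<^esub> x)) =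
          f y \<otimes>\<^bsub>R\<^esub> (g \<otimes>\<^bsub>RG\<^esub> h) (inv\<^bsub>G\<^esub> y \<otimes>\<^bsub>G\<^esub> x)"
        using fin(2) by (simp add: R.finsum_rdistr R.m_assoc Pi_iff)
    qed (use mult_RG_closed[OF g h] in \<open>auto simp: RG_closed\<close>)
    also have "\<dots> = (f \<otimes>\<^bsub>RG\<^esub> (g \<otimes>\<^bsub>RG\<^esub> h)) x"
      using f g h x fin(1) by (intro mult_RG[symmetric] mult_RG_closed) auto
    finally show ?thesis .
  qed (simp add: mult_RG_outside)
qed

section \<open>Monomials and the ring axioms\<close>

definition monom :: "'r \<Rightarrow> 'g \<Rightarrow> 'g \<Rightarrow> 'r" where
  "monom c u = (\<lambda>x. if x = u then c else \<zero>\<^bsub>R\<^esub>)"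

lemma monom_closed: "c \<in> carrier R \<Longrightarrow> u \<in> carrier G \<Longrightarrow> monom c u \<in> carrier RG"
  by (auto simp: carrier_RG monom_def supp_def)

lemma monom_mult:
  assumes "c \<in> carrier R" "u \<in> carrier G" "f \<in> carrier RG" "x \<in> carrier G"
  shows "(monom c u \<otimes>\<^bsub>RG\<^esub> f) x = c \<otimes>\<^bsub>R\<^esub> f (inv\<^bsub>G\<^esub> u \<otimes>\<^bsub>G\<^esub> x)"
proof -
  have "(monom c u \<otimes>\<^bsub>RG\<^esub> f) x = (\<Oplus>\<^bsub>R\<^esub>y\<in>{u}. monom c u y \<otimes>\<^bsub>R\<^esub> f (inv\<^bsub>G\<^esub> y \<otimes>\<^bsub>G\<^esub> x))"
    using assms by (intro mult_RG monom_closed) (auto simp: supp_def monom_def)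
  then show ?thesis using assms by (simp add: monom_def RG_closed)
qed

lemma mult_monom:
  assumes "c \<in> carrier R" "u \<in> carrier G" "f \<in> carrier RG" "x \<in> carrier G"
  shows "(f \<otimes>\<^bsub>RG\<^esub> monom c u) x = f (x \<otimes>\<^bsub>G\<^esub> inv\<^bsub>G\<^esub> u) \<otimes>\<^bsub>R\<^esub> c"
proof -
  let ?a = "x \<otimes>\<^bsub>G\<^esub> inv\<^bsub>G\<^esub> u"
  \<comment> \<open>The point \<open>?a\<close> is added to the range so that the one surviving term
    is present even if \<open>f\<close> vanishes there.\<close>
  have "(f \<otimes>\<^bsub>RG\<^esub> monom c u) x =
      (\<Oplus>\<^bsub>R\<^esub>y\<in>insert ?a (supp f). f y \<otimes>\<^bsub>R\<^esub> monom c u (inv\<^bsub>G\<^esub> y \<otimes>\<^bsub>G\<^esub> x))"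
    using assms by (intro mult_RG monom_closed) (auto simp: finite_supp)
  also have "\<dots> = f ?a \<otimes>\<^bsub>R\<^esub> monom c u (inv\<^bsub>G\<^esub> ?a \<otimes>\<^bsub>G\<^esub> x)"
  proof (rule R.finsum_eq_single)
    fix y assume y: "y \<in> insert ?a (supp f)" "y \<noteq> ?a"
    then have yc: "y \<in> carrier G" using assms supp_subset by auto
    have "inv\<^bsub>G\<^esub> y \<otimes>\<^bsub>G\<^esub> x \<noteq> u"
    proof
      assume "inv\<^bsub>G\<^esub> y \<otimes>\<^bsub>G\<^esub> x = u"
      then have "x = y \<otimes>\<^bsub>G\<^esub> u" using G.inv_solve_left[of u y x] assms yc by auto
      then have "y = ?a" using G.inv_solve_right[of y x u] assms yc by auto
      then show False using y by simp
    qed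
    then show "f y \<otimes>\<^bsub>R\<^esub> monom c u (inv\<^bsub>G\<^esub> y \<otimes>\<^bsub>G\<^esub> x) = \<zero>\<^bsub>R\<^esub>"
      using assms by (simp add: monom_def RG_closed)
  qed (use assms in \<open>auto simp: finite_supp RG_closed monom_def\<close>)
  also have "inv\<^bsub>G\<^esub> ?a \<otimes>\<^bsub>G\<^esub> x = u" using assms by (simp add: G.inv_mult_group G.m_assoc)
  finally show ?thesis by (simp add: monom_def)
qed

lemma one_RG_monom: "\<one>\<^bsub>RG\<^esub> = monom \<one>\<^bsub>R\<^esub> \<one>\<^bsub>G\<^esub>"
  by (simp add: one_RG monom_def)

lemma RG_eqI:
  assumes "f \<in> carrier RG" "h \<in> carrier RG" "\<And>x. x \<in> carrier G \<Longrightarrow> f x = h x"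
  shows "f = h"
proof
  fix x show "f x = h x" using assms RG_outside[OF assms(1)] RG_outside[OF assms(2)] by (cases "x \<in> carrier G") auto
qed

lemma ring_RG: "ring RG"
proof (rule ringI)
  show "abelian_group RG"
  proof (rule abelian_groupI)
    fix f assume f: "f \<in> carrier RG"
    have "(\<lambda>x. \<ominus>\<^bsub>R\<^esub> f x) \<in> carrier RG"
      using f by (auto simp: carrier_RG supp_def)
    moreover have "(\<lambda>x. \<ominus>\<^bsub>R\<^esub> f x) \<oplus>\<^bsub>RG\<^esub> f = \<zero>\<^bsub>RG\<^esub>"
      using RG_closed[OF f] by (simp add: add_RG zero_RG R.l_neg)
    ultimately show "\<exists>g\<in>carrier RG. g \<oplus>\<^bsub>RG\<^esub> f = \<zero>\<^bsub>RG\<^esub>" by blast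
  next
    show "\<zero>\<^bsub>RG\<^esub> \<in> carrier RG" by (simp add: carrier_RG zero_RG supp_def)
  next
    fix f g h assume "f \<in> carrier RG" "g \<in> carrier RG" "h \<in> carrier RG"
    then show "f \<oplus>\<^bsub>RG\<^esub> g \<oplus>\<^bsub>RG\<^esub> h = f \<oplus>\<^bsub>RG\<^esub> (g \<oplus>\<^bsub>RG\<^esub> h)"
      by (simp add: add_RG RG_closed R.a_assoc)
  next
    fix f g assume "f \<in> carrier RG" "g \<in> carrier RG"
    then show "f \<oplus>\<^bsub>RG\<^esub> g = g \<oplus>\<^bsub>RG\<^esub> f"
      by (simp add: add_RG RG_closed R.a_comm)
  qed (simp_all add: add_RG_closed, simp add: add_RG zero_RG RG_closed)
  show "monoid RG"
  proof (rule monoidI)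
    show one: "\<one>\<^bsub>RG\<^esub> \<in> carrier RG" by (simp add: one_RG_monom monom_closed)
    fix f assume f: "f \<in> carrier RG"
    show "\<one>\<^bsub>RG\<^esub> \<otimes>\<^bsub>RG\<^esub> f = f"
      using f one by (intro RG_eqI mult_RG_closed) (auto simp: one_RG_monom monom_mult RG_closed)
    show "f \<otimes>\<^bsub>RG\<^esub> \<one>\<^bsub>RG\<^esub> = f"
      using f one by (intro RG_eqI mult_RG_closed) (auto simp: one_RG_monom mult_monom RG_closed)
  qed (simp_all add: mult_RG_closed mult_RG_assoc)
next
  fix f g h assume *: "f \<in> carrier RG" "g \<in> carrier RG" "h \<in> carrier RG"
  note cl [simp] = RG_closed[OF *(1)] RG_closed[OF *(2)] RG_closed[OF *(3)]
  show "(f \<oplus>\<^bsub>RG\<^esub> g) \<otimes>\<^bsub>RG\<^esub> h = f \<otimes>\<^bsub>RG\<^esub> h \<oplus>\<^bsub>RG\<^esub> g \<otimes>\<^bsub>RG\<^esub> h"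
  proof (rule RG_eqI)
    fix x assume x: "x \<in> carrier G"
    let ?A = "supp f \<union> supp g"
    have A: "finite ?A" "supp (f \<oplus>\<^bsub>RG\<^esub> g) \<subseteq> ?A" using * finite_supp by (auto simp: supp_def add_RG)
    have "((f \<oplus>\<^bsub>RG\<^esub> g) \<otimes>\<^bsub>RG\<^esub> h) x = (\<Oplus>\<^bsub>R\<^esub>y\<in>?A. (f \<oplus>\<^bsub>RG\<^esub> g) y \<otimes>\<^bsub>R\<^esub> h (inv\<^bsub>G\<^esub> y \<otimes>\<^bsub>G\<^esub> x))"
      using * x A by (intro mult_RG add_RG_closed)
    also have "\<dots> = (\<Oplus>\<^bsub>R\<^esub>y\<in>?A. f y \<otimes>\<^bsub>R\<^esub> h (inv\<^bsub>G\<^esub> y \<otimes>\<^bsub>G\<^esub> x) \<oplus>\<^bsub>R\<^esub> g y \<otimes>\<^bsub>R\<^esub> h (inv\<^bsub>G\<^esub> y \<otimes>\<^bsub>G\<^esub> x))"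
      by (intro R.finsum_cong') (auto simp: add_RG R.l_distr)
    also have "\<dots> = (f \<otimes>\<^bsub>RG\<^esub> h) x \<oplus>\<^bsub>R\<^esub> (g \<otimes>\<^bsub>RG\<^esub> h) x"
      using mult_RG[OF *(1,3) x A(1)] mult_RG[OF *(2,3) x A(1)] by (simp add: R.finsum_addf Pi_iff)
    finally show "((f \<oplus>\<^bsub>RG\<^esub> g) \<otimes>\<^bsub>RG\<^esub> h) x = (f \<otimes>\<^bsub>RG\<^esub> h \<oplus>\<^bsub>RG\<^esub> g \<otimes>\<^bsub>RG\<^esub> h) x" by (simp add: add_RG)
  qed (intro add_RG_closed mult_RG_closed *)+
  show "h \<otimes>\<^bsub>RG\<^esub> (f \<oplus>\<^bsub>RG\<^esub> g) = h \<otimes>\<^bsub>RG\<^esub> f \<oplus>\<^bsub>RG\<^esub> h \<otimes>\<^bsub>RG\<^esub> g"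
  proof (rule RG_eqI)
    fix x assume x: "x \<in> carrier G"
    note A = finite_supp[OF *(3)] subset_refl
    have "(h \<otimes>\<^bsub>RG\<^esub> (f \<oplus>\<^bsub>RG\<^esub> g)) x = (\<Oplus>\<^bsub>R\<^esub>y\<in>supp h. h y \<otimes>\<^bsub>R\<^esub> (f \<oplus>\<^bsub>RG\<^esub> g) (inv\<^bsub>G\<^esub> y \<otimes>\<^bsub>G\<^esub> x))"
      using * x A by (intro mult_RG add_RG_closed)
    also have "\<dots> = (\<Oplus>\<^bsub>R\<^esub>y\<in>supp h. h y \<otimes>\<^bsub>R\<^esub> f (inv\<^bsub>G\<^esub> y \<otimes>\<^bsub>G\<^esub> x) \<oplus>\<^bsub>R\<^esub> h y \<otimes>\<^bsub>R\<^esub> g (inv\<^bsub>G\<^esub> y \<otimes>\<^bsub>G\<^esub> x))"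
      by (intro R.finsum_cong') (auto simp: add_RG R.r_distr)
    also have "\<dots> = (h \<otimes>\<^bsub>RG\<^esub> f) x \<oplus>\<^bsub>R\<^esub> (h \<otimes>\<^bsub>RG\<^esub> g) x"
      using mult_RG[OF *(3,1) x A] mult_RG[OF *(3,2) x A] by (simp add: R.finsum_addf Pi_iff)
    finally show "(h \<otimes>\<^bsub>RG\<^esub> (f \<oplus>\<^bsub>RG\<^esub> g)) x = (h \<otimes>\<^bsub>RG\<^esub> f \<oplus>\<^bsub>RG\<^esub> h \<otimes>\<^bsub>RG\<^esub> g) x" by (simp add: add_RG)
  qed (intro add_RG_closed mult_RG_closed *)+
qed

sublocale RG: ring RG
  by (rule ring_RG)

end

section \<open>Supports of products\<close>

text \<open>A position hit by only one element of \<open>E\<close> belongs to \<open>Y\<close>. If a good element does not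
  contribute to \<open>Y\<close>, its position is therefore shared with a bad one.\<close>

lemma card_le_unique_positions:
  assumes fin: "finite E" "finite Y" and good: "D \<subseteq> E" "inj_on pos D"
    and uniq: "\<And>e. e \<in> E \<Longrightarrow> (\<And>e'. e' \<in> E \<Longrightarrow> pos e' = pos e \<Longrightarrow> e' = e) \<Longrightarrow> pos e \<in> Y"
  shows "card D \<le> card Y + card (E - D)"
proof -
  let ?D1 = "{e \<in> D. pos e \<in> Y}" and ?D2 = "{e \<in> D. pos e \<notin> Y}"
  have finD: "finite D" using fin(1) good(1) finite_subset by blast
  have "\<forall>e \<in> ?D2. \<exists>e'. e' \<in> E - D \<and> pos e' = pos e"
  proof
    fix e assume e: "e \<in> ?D2"
    then obtain e' where e': "e' \<in> E" "pos e' = pos e" "e' \<noteq> e"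
      using uniq good(1) by blast
    then have "e' \<notin> D" using e good(2) by (auto dest: inj_onD)
    then show "\<exists>e'. e' \<in> E - D \<and> pos e' = pos e" using e' by blast
  qed
  from bchoice[OF this] obtain c
    where c: "\<And>e. e \<in> ?D2 \<Longrightarrow> c e \<in> E - D" "\<And>e. e \<in> ?D2 \<Longrightarrow> pos (c e) = pos e"
    by auto
  have "inj_on c ?D2"
  proof (rule inj_onI)
    fix e e' assume *: "e \<in> ?D2" "e' \<in> ?D2" "c e = c e'"
    then have "pos e = pos e'" using c(2) by metis
    then show "e = e'" using * good(2) by (auto dest: inj_onD)
  qed
  then have "card ?D2 \<le> card (E - D)"
    using c(1) fin(1) by (intro card_inj_on_le[of c]) auto
  moreover have "card ?D1 \<le> card Y"
    using fin(2) good(2) by (intro card_inj_on_le[of pos]) (auto intro: inj_on_subset)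
  moreover have "D = ?D1 \<union> ?D2" by blast
  then have "card D \<le> card ?D1 + card ?D2" by (metis card_Un_le)
  ultimately show ?thesis by simp
qed

text \<open>Let \<open>N\<close> be the sum of the \<open>card (W i)\<close>. Of the
  \<open>k * N\<close> triples \<open>(i, u, g)\<close> at most \<open>N\<close> are bad, since a
  pair \<open>(i, g)\<close> has at most one bad \<open>u\<close>. Good triples have distinct
  positions, and one whose position lies outside \<open>Y\<close> shares it with a bad triple, so
  there are at most \<open>card Y + N\<close> good ones. The weight \<open>k\<close> is 3 and 5 in
  the applications.\<close>

lemma card_spread_bound:
  assumes fin: "finite I" "finite Y" "\<And>i. i \<in> I \<Longrightarrow> finite (Z i)" "\<And>i. i \<in> I \<Longrightarrow> finite (W i)"
    and k: "\<And>i. i \<in> I \<Longrightarrow> card (Z i) = k"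
    and bad: "\<And>i g u v. \<lbrakk>i \<in> I; g \<in> W i; u \<in> Z i; v \<in> Z i; \<not> P i u g; \<not> P i v g\<rbrakk> \<Longrightarrow> u = v"
    and inj: "inj_on pos {(i, u, g). i \<in> I \<and> u \<in> Z i \<and> g \<in> W i \<and> P i u g}"
    and uniq: "\<And>i u g. \<lbrakk>i \<in> I; u \<in> Z i; g \<in> W i;
       \<And>j v h. \<lbrakk>j \<in> I; v \<in> Z j; h \<in> W j; pos (j, v, h) = pos (i, u, g)\<rbrakk> \<Longrightarrow> (j, v, h) = (i, u, g)\<rbrakk> \<Longrightarrow>
       pos (i, u, g) \<in> Y"
  shows "k * (\<Sum>i\<in>I. card (W i)) \<le> card Y + 2 * (\<Sum>i\<in>I. card (W i))"
proof -
  define E where "E = (SIGMA i:I. Z i \<times> W i)"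
  define D where "D = {(i, u, g). i \<in> I \<and> u \<in> Z i \<and> g \<in> W i \<and> P i u g}"
  have finE: "finite E" using fin by (simp add: E_def)
  have DE: "D \<subseteq> E" by (auto simp: D_def E_def)
  have cE: "card E = k * (\<Sum>i\<in>I. card (W i))"
    using fin k by (simp add: E_def card_cartesian_product sum_distrib_left)
  have "card (E - D) \<le> card (SIGMA i:I. W i)"
  proof (rule card_inj_on_le[of "\<lambda>(i, u, g). (i, g)"])
    show "inj_on (\<lambda>(i, u, g). (i, g)) (E - D)"
      by (auto simp: inj_on_def E_def D_def intro: bad)
  qed (use fin in \<open>auto simp: E_def\<close>)
  then have cb: "card (E - D) \<le> (\<Sum>i\<in>I. card (W i))" using fin by simp
  have "card D \<le> card Y + card (E - D)"
  proof (rule card_le_unique_positions[OF finE fin(2) DE])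
    show "inj_on pos D" using inj by (simp add: D_def)
    fix e assume e: "e \<in> E" and u: "\<And>e'. e' \<in> E \<Longrightarrow> pos e' = pos e \<Longrightarrow> e' = e"
    obtain i v g where "e = (i, v, g)" by (cases e)
    then show "pos e \<in> Y" using e u by (auto simp: E_def intro!: uniq)
  qed
  moreover have "card E = card D + card (E - D)"
    using DE finE by (metis card_Diff_subset card_mono finite_subset le_add_diff_inverse)
  ultimately show ?thesis using cE cb by linarith
qed

context group_ring_context
begin

lemma finsum_RG_apply:
  assumes "finite I" "\<And>i. i \<in> I \<Longrightarrow> f i \<in> carrier RG"
  shows "(\<Oplus>\<^bsub>RG\<^esub>i\<in>I. f i) x = (\<Oplus>\<^bsub>R\<^esub>i\<in>I. f i x)"
  using assms
proof (induction I)
  case empty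
  then show ?case by (simp add: zero_RG)
next
  case (insert i I)
  then have "(\<Oplus>\<^bsub>RG\<^esub>i\<in>insert i I. f i) = f i \<oplus>\<^bsub>RG\<^esub> (\<Oplus>\<^bsub>RG\<^esub>i\<in>I. f i)" by (simp add: Pi_iff)
  then show ?case using insert by (simp add: add_RG Pi_iff RG_closed)
qed

text \<open>In the group ring this is the formal sum of the elements of \<open>X\<close>. The
  factors on both sides of \<open>b\<close> in the generators of the right ideal have this
  form.\<close>

definition ind :: "'g set \<Rightarrow> 'g \<Rightarrow> 'r" where
  "ind X = (\<lambda>x. if x \<in> X then \<one>\<^bsub>R\<^esub> else \<zero>\<^bsub>R\<^esub>)"

lemma ind_closed: "finite X \<Longrightarrow> X \<subseteq> carrier G \<Longrightarrow> ind X \<in> carrier RG"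
  by (auto simp: carrier_RG ind_def supp_def intro: finite_subset[of _ X])

lemma ind_mult:
  assumes "finite X" "X \<subseteq> carrier G" "f \<in> carrier RG" "x \<in> carrier G"
  shows "(ind X \<otimes>\<^bsub>RG\<^esub> f) x = (\<Oplus>\<^bsub>R\<^esub>u\<in>X. f (inv\<^bsub>G\<^esub> u \<otimes>\<^bsub>G\<^esub> x))"
proof -
  have "(ind X \<otimes>\<^bsub>RG\<^esub> f) x = (\<Oplus>\<^bsub>R\<^esub>u\<in>X. ind X u \<otimes>\<^bsub>R\<^esub> f (inv\<^bsub>G\<^esub> u \<otimes>\<^bsub>G\<^esub> x))"
    using assms by (intro mult_RG ind_closed) (auto simp: supp_def ind_def)
  also have "\<dots> = (\<Oplus>\<^bsub>R\<^esub>u\<in>X. f (inv\<^bsub>G\<^esub> u \<otimes>\<^bsub>G\<^esub> x))"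
    using RG_closed[OF assms(3)] by (intro R.finsum_cong') (auto simp: ind_def)
  finally show ?thesis .
qed

lemma mult_inv_in_supp:
  assumes "f \<in> carrier RG" "u \<in> carrier G" "x \<in> carrier G" "f (inv\<^bsub>G\<^esub> u \<otimes>\<^bsub>G\<^esub> x) \<noteq> \<zero>\<^bsub>R\<^esub>"
  shows "inv\<^bsub>G\<^esub> u \<otimes>\<^bsub>G\<^esub> x \<in> supp f" "u \<otimes>\<^bsub>G\<^esub> (inv\<^bsub>G\<^esub> u \<otimes>\<^bsub>G\<^esub> x) = x"
  using assms by (simp_all add: supp_def flip: G.m_assoc)

text \<open>Every other term of the convolution would give a second factorization of
  \<open>u g\<close> with a different first factor. The coefficient of \<open>f\<close> is therefore
  copied unchanged.\<close>

lemma ind_mult_single: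
  assumes X: "finite X" "X \<subseteq> carrier G" and f: "f \<in> carrier RG" and u: "u \<in> X" and g: "g \<in> carrier G"
    and uniq: "\<And>v h. \<lbrakk>v \<in> X; h \<in> supp f; v \<otimes>\<^bsub>G\<^esub> h = u \<otimes>\<^bsub>G\<^esub> g\<rbrakk> \<Longrightarrow> v = u"
  shows "(ind X \<otimes>\<^bsub>RG\<^esub> f) (u \<otimes>\<^bsub>G\<^esub> g) = f g"
proof -
  have uc: "u \<in> carrier G" using u X by auto
  have "(ind X \<otimes>\<^bsub>RG\<^esub> f) (u \<otimes>\<^bsub>G\<^esub> g) = (\<Oplus>\<^bsub>R\<^esub>v\<in>X. f (inv\<^bsub>G\<^esub> v \<otimes>\<^bsub>G\<^esub> (u \<otimes>\<^bsub>G\<^esub> g)))"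
    using X f uc g by (intro ind_mult) auto
  also have "\<dots> = f (inv\<^bsub>G\<^esub> u \<otimes>\<^bsub>G\<^esub> (u \<otimes>\<^bsub>G\<^esub> g))"
  proof (rule R.finsum_eq_single[OF X(1) u])
    fix v assume v: "v \<in> X" "v \<noteq> u"
    then have "v \<in> carrier G" using X by auto
    then show "f (inv\<^bsub>G\<^esub> v \<otimes>\<^bsub>G\<^esub> (u \<otimes>\<^bsub>G\<^esub> g)) = \<zero>\<^bsub>R\<^esub>"
      using mult_inv_in_supp[OF f _ G.m_closed[OF uc g]] uniq v by blast
  qed (rule RG_closed[OF f])
  also have "inv\<^bsub>G\<^esub> u \<otimes>\<^bsub>G\<^esub> (u \<otimes>\<^bsub>G\<^esub> g) = g" using uc g by (simp flip: G.m_assoc)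
  finally show ?thesis .
qed

lemma ind_mult_eq_zero:
  assumes X: "finite X" "X \<subseteq> carrier G" and f: "f \<in> carrier RG" and x: "x \<in> carrier G"
    and none: "\<And>v h. \<lbrakk>v \<in> X; h \<in> supp f\<rbrakk> \<Longrightarrow> v \<otimes>\<^bsub>G\<^esub> h \<noteq> x"
  shows "(ind X \<otimes>\<^bsub>RG\<^esub> f) x = \<zero>\<^bsub>R\<^esub>"
proof -
  have "(ind X \<otimes>\<^bsub>RG\<^esub> f) x = (\<Oplus>\<^bsub>R\<^esub>v\<in>X. f (inv\<^bsub>G\<^esub> v \<otimes>\<^bsub>G\<^esub> x))"
    using X f x by (intro ind_mult)
  also have "\<dots> = (\<Oplus>\<^bsub>R\<^esub>v\<in>X. \<zero>\<^bsub>R\<^esub>)"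
    using mult_inv_in_supp[OF f _ x] none X(2) by (intro R.finsum_cong') (auto, blast)
  finally show ?thesis by (simp add: R.finsum_zero)
qed

text \<open>The triples \<open>(s, u, g)\<close> from \<open>supp b\<close>, \<open>Z\<close> and
  \<open>supp r\<close> are counted with weight 3, which after the loss of 2 leaves the factor
  \<open>card (supp b)\<close>, at least 1. A position hit by a single triple carries the
  coefficient \<open>b s \<otimes> r g\<close>, nonzero because \<open>R\<close> is a
  domain.\<close>

lemma card_supp_mult_ind_mult:
  assumes dom: "noncomm_domain R" and b: "b \<in> carrier RG" "b \<noteq> \<zero>\<^bsub>RG\<^esub>" and r: "r \<in> carrier RG"
    and sp: "spread G (supp b) Z' A" and Z: "Z \<subseteq> Z'" "card Z = 3"
  shows "card (supp r) \<le> card (supp (b \<otimes>\<^bsub>RG\<^esub> (ind Z \<otimes>\<^bsub>RG\<^esub> r)))"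
proof -
  let ?S = "supp b" and ?h = "ind Z \<otimes>\<^bsub>RG\<^esub> r"
  let ?Y = "supp (b \<otimes>\<^bsub>RG\<^esub> ?h)"
  have finZ: "finite Z" using Z(2) by (metis card.infinite zero_neq_numeral)
  have Zc: "Z \<subseteq> carrier G" using sp Z(1) by (auto simp: spread_def)
  have hc: "?h \<in> carrier RG" by (intro mult_RG_closed ind_closed finZ Zc r)
  have "3 * (\<Sum>s\<in>?S. card (supp r)) \<le> card ?Y + 2 * (\<Sum>s\<in>?S. card (supp r))"
  proof (rule card_spread_bound[where Z = "\<lambda>_. Z" and P = "\<lambda>s u g. g \<in> A u" and pos = "\<lambda>(s, u, g). s \<otimes>\<^bsub>G\<^esub> (u \<otimes>\<^bsub>G\<^esub> g)"])
    show "finite ?S" "finite (supp r)" "finite ?Y"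
      using b r hc by (auto intro!: finite_supp mult_RG_closed)
    show "u = v" if "g \<in> supp r" "u \<in> Z" "v \<in> Z" "g \<notin> A u" "g \<notin> A v" for g u v
      using that Z(1) supp_subset by (intro spread_miss[OF sp, of g]) auto
    show "inj_on (\<lambda>(s, u, g). s \<otimes>\<^bsub>G\<^esub> (u \<otimes>\<^bsub>G\<^esub> g)) {(s, u, g). s \<in> ?S \<and> u \<in> Z \<and> g \<in> supp r \<and> g \<in> A u}"
    proof (rule inj_onI, clarify, unfold prod.inject)
      fix s u g t v h
      assume *: "s \<in> ?S" "u \<in> Z" "g \<in> supp r" "g \<in> A u" "t \<in> ?S" "v \<in> Z" "h \<in> supp r" "h \<in> A v"
        "s \<otimes>\<^bsub>G\<^esub> (u \<otimes>\<^bsub>G\<^esub> g) = t \<otimes>\<^bsub>G\<^esub> (v \<otimes>\<^bsub>G\<^esub> h)"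
      then show "s = t \<and> u = v \<and> g = h"
        using supp_subset[of r] Z(1) by (intro spread_inject[OF sp *(1) _ _ *(4,5) _ _ *(8)]) auto
    qed
    fix s u g assume s: "s \<in> ?S" and u: "u \<in> Z" and g: "g \<in> supp r"
      and uniq: "\<And>t v h. \<lbrakk>t \<in> ?S; v \<in> Z; h \<in> supp r;
         (case (t, v, h) of (s, u, g) \<Rightarrow> s \<otimes>\<^bsub>G\<^esub> (u \<otimes>\<^bsub>G\<^esub> g)) = (case (s, u, g) of (s, u, g) \<Rightarrow> s \<otimes>\<^bsub>G\<^esub> (u \<otimes>\<^bsub>G\<^esub> g))\<rbrakk> \<Longrightarrow>
         (t, v, h) = (s, u, g)"
    have cl: "s \<in> carrier G" "u \<in> carrier G" "g \<in> carrier G" using s u g supp_subset Zc by auto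
    let ?x = "s \<otimes>\<^bsub>G\<^esub> (u \<otimes>\<^bsub>G\<^esub> g)"
    have x: "?x \<in> carrier G" using cl by simp
    have "(b \<otimes>\<^bsub>RG\<^esub> ?h) ?x = (\<Oplus>\<^bsub>R\<^esub>t\<in>?S. b t \<otimes>\<^bsub>R\<^esub> ?h (inv\<^bsub>G\<^esub> t \<otimes>\<^bsub>G\<^esub> ?x))"
      using b hc x by (intro mult_RG finite_supp) auto
    \<comment> \<open>For \<open>t \<noteq> s\<close> a nonzero contribution would come from a
      triple starting with \<open>t\<close> at the same position, against
      \<open>uniq\<close>.\<close>
    also have "\<dots> = b s \<otimes>\<^bsub>R\<^esub> ?h (inv\<^bsub>G\<^esub> s \<otimes>\<^bsub>G\<^esub> ?x)"
    proof (rule R.finsum_eq_single)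
      fix t assume t: "t \<in> ?S" "t \<noteq> s"
      have tc: "t \<in> carrier G" using t supp_subset by blast
      have "?h (inv\<^bsub>G\<^esub> t \<otimes>\<^bsub>G\<^esub> ?x) = \<zero>\<^bsub>R\<^esub>"
      proof (rule ind_mult_eq_zero[OF finZ Zc r])
        fix v h assume vh: "v \<in> Z" "h \<in> supp r"
        show "v \<otimes>\<^bsub>G\<^esub> h \<noteq> inv\<^bsub>G\<^esub> t \<otimes>\<^bsub>G\<^esub> ?x"
        proof
          assume "v \<otimes>\<^bsub>G\<^esub> h = inv\<^bsub>G\<^esub> t \<otimes>\<^bsub>G\<^esub> ?x"
          then have "t \<otimes>\<^bsub>G\<^esub> (v \<otimes>\<^bsub>G\<^esub> h) = ?x" using tc x by (simp flip: G.m_assoc)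
          then show False using uniq[OF t(1) vh] t(2) by simp
        qed
      qed (use tc x in simp)
      then show "b t \<otimes>\<^bsub>R\<^esub> ?h (inv\<^bsub>G\<^esub> t \<otimes>\<^bsub>G\<^esub> ?x) = \<zero>\<^bsub>R\<^esub>" using b(1) by (simp add: RG_closed)
    qed (use s b hc in \<open>auto simp: finite_supp RG_closed\<close>)
    also have "inv\<^bsub>G\<^esub> s \<otimes>\<^bsub>G\<^esub> ?x = u \<otimes>\<^bsub>G\<^esub> g" using cl by (simp flip: G.m_assoc)
    also have "?h (u \<otimes>\<^bsub>G\<^esub> g) = r g"
    proof (rule ind_mult_single[OF finZ Zc r u])
      fix v h assume "v \<in> Z" "h \<in> supp r" "v \<otimes>\<^bsub>G\<^esub> h = u \<otimes>\<^bsub>G\<^esub> g"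
      then show "v = u" using uniq[OF s, of v h] by simp
    qed (use cl in simp)
    finally have "(b \<otimes>\<^bsub>RG\<^esub> ?h) ?x = b s \<otimes>\<^bsub>R\<^esub> r g" .
    moreover have "b s \<otimes>\<^bsub>R\<^esub> r g \<noteq> \<zero>\<^bsub>R\<^esub>"
      using dom s g RG_closed[OF b(1), of s] RG_closed[OF r, of g]
      unfolding noncomm_domain_def supp_def by blast
    ultimately show "(case (s, u, g) of (s, u, g) \<Rightarrow> s \<otimes>\<^bsub>G\<^esub> (u \<otimes>\<^bsub>G\<^esub> g)) \<in> ?Y"
      using x by (simp add: supp_def)
  qed (use finZ Z(2) in auto)
  then have "card ?S * card (supp r) \<le> card ?Y" by simp
  moreover have "card ?S \<noteq> 0" using b by (simp add: finite_supp supp_empty_iff)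
  then have "card (supp r) \<le> card ?S * card (supp r)" by simp
  ultimately show ?thesis by (rule order_trans[rotated])
qed

text \<open>The count with weight 5 leaves the factor 3. Since the sets \<open>X b\<close> are
  disjoint, \<open>u\<close> determines the index \<open>b\<close>, so terms of different summands
  are kept apart as well.\<close>

lemma card_supp_sum_ind_mult:
  assumes T: "finite T" and C: "\<And>b. b \<in> T \<Longrightarrow> C b \<in> carrier RG"
    and sp: "spread G {\<one>\<^bsub>G\<^esub>} U A" and X: "\<And>b. b \<in> T \<Longrightarrow> X b \<subseteq> U" "\<And>b. b \<in> T \<Longrightarrow> card (X b) = 5"
    and disj: "\<And>b c u. \<lbrakk>b \<in> T; c \<in> T; u \<in> X b; u \<in> X c\<rbrakk> \<Longrightarrow> b = c"
  shows "3 * (\<Sum>b\<in>T. card (supp (C b))) \<le> card (supp (\<Oplus>\<^bsub>RG\<^esub>b\<in>T. ind (X b) \<otimes>\<^bsub>RG\<^esub> C b))"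
proof -
  let ?y = "\<Oplus>\<^bsub>RG\<^esub>b\<in>T. ind (X b) \<otimes>\<^bsub>RG\<^esub> C b"
  have finX: "finite (X b)" if "b \<in> T" for b using X(2)[OF that] by (metis card.infinite zero_neq_numeral)
  have Uc: "U \<subseteq> carrier G" using sp by (auto simp: spread_def)
  have Xc: "X b \<subseteq> carrier G" if "b \<in> T" for b using X(1)[OF that] Uc by auto
  have tc: "ind (X b) \<otimes>\<^bsub>RG\<^esub> C b \<in> carrier RG" if "b \<in> T" for b
    using that by (intro mult_RG_closed ind_closed finX Xc C)
  have inj: "u = v \<and> g = h" if "u \<in> U" "v \<in> U" "g \<in> carrier G" "h \<in> carrier G" "g \<in> A u" "h \<in> A v"
      "u \<otimes>\<^bsub>G\<^esub> g = v \<otimes>\<^bsub>G\<^esub> h" for u v g h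
  proof -
    have "\<one>\<^bsub>G\<^esub> \<otimes>\<^bsub>G\<^esub> (u \<otimes>\<^bsub>G\<^esub> g) = \<one>\<^bsub>G\<^esub> \<otimes>\<^bsub>G\<^esub> (v \<otimes>\<^bsub>G\<^esub> h)" using that(7) by simp
    then show ?thesis
      using spread_inject[OF sp _ that(1,3,5) _ that(2,4,6)] by simp
  qed
  have "5 * (\<Sum>b\<in>T. card (supp (C b))) \<le> card (supp ?y) + 2 * (\<Sum>b\<in>T. card (supp (C b)))"
  proof (rule card_spread_bound[where Z = X and P = "\<lambda>b u g. g \<in> A u" and pos = "\<lambda>(b, u, g). u \<otimes>\<^bsub>G\<^esub> g"])
    show "finite (supp ?y)" using tc by (intro finite_supp RG.finsum_closed) auto
    show "finite (supp (C b))" if "b \<in> T" for b using that C by (intro finite_supp)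
    show "u = v" if "b \<in> T" "g \<in> supp (C b)" "u \<in> X b" "v \<in> X b" "g \<notin> A u" "g \<notin> A v" for b g u v
      using that X(1)[OF that(1)] supp_subset by (intro spread_miss[OF sp, of g]) auto
    show "inj_on (\<lambda>(b, u, g). u \<otimes>\<^bsub>G\<^esub> g) {(b, u, g). b \<in> T \<and> u \<in> X b \<and> g \<in> supp (C b) \<and> g \<in> A u}"
    proof (rule inj_onI, clarify, unfold prod.inject)
      fix b u g c v h
      assume *: "b \<in> T" "u \<in> X b" "g \<in> supp (C b)" "g \<in> A u" "c \<in> T" "v \<in> X c" "h \<in> supp (C c)" "h \<in> A v"
        "u \<otimes>\<^bsub>G\<^esub> g = v \<otimes>\<^bsub>G\<^esub> h"
      then have "u = v \<and> g = h" using supp_subset X(1) by (intro inj) auto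
      then show "b = c \<and> u = v \<and> g = h" using disj * by blast
    qed
    fix b u g assume b: "b \<in> T" and u: "u \<in> X b" and g: "g \<in> supp (C b)"
      and uniq: "\<And>c v h. \<lbrakk>c \<in> T; v \<in> X c; h \<in> supp (C c);
        (case (c, v, h) of (b, u, g) \<Rightarrow> u \<otimes>\<^bsub>G\<^esub> g) = (case (b, u, g) of (b, u, g) \<Rightarrow> u \<otimes>\<^bsub>G\<^esub> g)\<rbrakk> \<Longrightarrow>
        (c, v, h) = (b, u, g)"
    have cl: "u \<in> carrier G" "g \<in> carrier G" using u g supp_subset Xc[OF b] by auto
    let ?x = "u \<otimes>\<^bsub>G\<^esub> g"
    have "?y ?x = (\<Oplus>\<^bsub>R\<^esub>c\<in>T. (ind (X c) \<otimes>\<^bsub>RG\<^esub> C c) ?x)"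
      using T tc by (rule finsum_RG_apply)
    also have "\<dots> = (ind (X b) \<otimes>\<^bsub>RG\<^esub> C b) ?x"
    proof (rule R.finsum_eq_single[OF T b])
      fix c assume c: "c \<in> T" "c \<noteq> b"
      show "(ind (X c) \<otimes>\<^bsub>RG\<^esub> C c) ?x = \<zero>\<^bsub>R\<^esub>"
      proof (rule ind_mult_eq_zero[OF finX Xc C])
        show "v \<otimes>\<^bsub>G\<^esub> h \<noteq> ?x" if "v \<in> X c" "h \<in> supp (C c)" for v h
          using uniq[OF c(1) that] c(2) by auto
      qed (use c cl in auto)
    qed (use tc[OF b] RG_closed in auto)
    also have "\<dots> = C b g"
    proof (rule ind_mult_single[OF finX[OF b] Xc[OF b] C[OF b] u cl(2)])
      show "v = u" if "v \<in> X b" "h \<in> supp (C b)" "v \<otimes>\<^bsub>G\<^esub> h = u \<otimes>\<^bsub>G\<^esub> g" for v h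
        using uniq[OF b that(1,2)] that(3) by simp
    qed
    finally show "(case (b, u, g) of (b, u, g) \<Rightarrow> u \<otimes>\<^bsub>G\<^esub> g) \<in> supp ?y"
      using g cl by (simp add: supp_def)
  qed (use T finX X(2) in auto)
  then show ?thesis by linarith
qed

text \<open>Let \<open>y\<close> be the part of the sum with the factors \<open>ind (X b)\<close>.
  If the whole sum is 1, then \<open>y\<close> equals 1 minus the sum of the \<open>r b\<close>, so
  its support has at most one element more than the supports of the \<open>r b\<close> together. The
  lower bound for \<open>supp y\<close> contradicts this unless all \<open>r b\<close> vanish, and
  then the sum is 0.\<close>

lemma comaximal_elements_independent:
  assumes dom: "noncomm_domain R"
    and T: "finite T" "T \<subseteq> carrier RG - {\<zero>\<^bsub>RG\<^esub>}" and r: "\<And>b. b \<in> T \<Longrightarrow> r b \<in> carrier RG"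
    and sp: "spread G {\<one>\<^bsub>G\<^esub>} U A" and X: "\<And>b. b \<in> T \<Longrightarrow> X b \<subseteq> U" "\<And>b. b \<in> T \<Longrightarrow> card (X b) = 5"
    and disj: "\<And>b c u. \<lbrakk>b \<in> T; c \<in> T; u \<in> X b; u \<in> X c\<rbrakk> \<Longrightarrow> b = c"
    and spb: "\<And>b. b \<in> T \<Longrightarrow> spread G (supp b) (Z' b) (A' b)"
    and Z: "\<And>b. b \<in> T \<Longrightarrow> Z b \<subseteq> Z' b" "\<And>b. b \<in> T \<Longrightarrow> card (Z b) = 3"
  shows "(\<Oplus>\<^bsub>RG\<^esub>b\<in>T. (ind (X b) \<otimes>\<^bsub>RG\<^esub> (b \<otimes>\<^bsub>RG\<^esub> ind (Z b)) \<oplus>\<^bsub>RG\<^esub> \<one>\<^bsub>RG\<^esub>) \<otimes>\<^bsub>RG\<^esub> r b) \<noteq> \<one>\<^bsub>RG\<^esub>"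
proof
  assume eq: "(\<Oplus>\<^bsub>RG\<^esub>b\<in>T. (ind (X b) \<otimes>\<^bsub>RG\<^esub> (b \<otimes>\<^bsub>RG\<^esub> ind (Z b)) \<oplus>\<^bsub>RG\<^esub> \<one>\<^bsub>RG\<^esub>) \<otimes>\<^bsub>RG\<^esub> r b) = \<one>\<^bsub>RG\<^esub>" (is "?sum = _")
  define C where "C b = b \<otimes>\<^bsub>RG\<^esub> (ind (Z b) \<otimes>\<^bsub>RG\<^esub> r b)" for b
  define y where "y = (\<Oplus>\<^bsub>RG\<^esub>b\<in>T. ind (X b) \<otimes>\<^bsub>RG\<^esub> C b)"
  have bc: "b \<in> carrier RG" if "b \<in> T" for b using T(2) that by auto
  have Uc: "U \<subseteq> carrier G" using sp by (auto simp: spread_def)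
  have iX: "ind (X b) \<in> carrier RG" if "b \<in> T" for b
    using X[OF that] Uc by (intro ind_closed) (auto intro: card_ge_0_finite)
  have iZ: "ind (Z b) \<in> carrier RG" if "b \<in> T" for b
    using Z[OF that] spb[OF that] by (intro ind_closed) (auto intro: card_ge_0_finite simp: spread_def)
  note cl = bc iX iZ r
  have Cc: "C b \<in> carrier RG" if "b \<in> T" for b using that cl by (simp add: C_def)
  have yc: "y \<in> carrier RG" using Cc cl by (auto simp: y_def intro!: RG.finsum_closed)
  have "?sum = (\<Oplus>\<^bsub>RG\<^esub>b\<in>T. ind (X b) \<otimes>\<^bsub>RG\<^esub> C b \<oplus>\<^bsub>RG\<^esub> r b)"
    using cl Cc
    by (intro RG.finsum_cong') (auto simp: C_def RG.l_distr RG.m_assoc)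
  also have "\<dots> = y \<oplus>\<^bsub>RG\<^esub> (\<Oplus>\<^bsub>RG\<^esub>b\<in>T. r b)"
    unfolding y_def using cl Cc by (intro RG.finsum_addf) auto
  finally have one: "\<one>\<^bsub>RG\<^esub> = y \<oplus>\<^bsub>RG\<^esub> (\<Oplus>\<^bsub>RG\<^esub>b\<in>T. r b)" using eq by simp
  let ?N = "\<Sum>b\<in>T. card (supp (C b))"
  have "supp y \<subseteq> insert \<one>\<^bsub>G\<^esub> (\<Union>b\<in>T. supp (r b))"
  proof
    fix x assume x: "x \<in> supp y"
    show "x \<in> insert \<one>\<^bsub>G\<^esub> (\<Union>b\<in>T. supp (r b))"
    proof (rule ccontr)
      assume n: "x \<notin> insert \<one>\<^bsub>G\<^esub> (\<Union>b\<in>T. supp (r b))"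
      have "(\<Oplus>\<^bsub>RG\<^esub>b\<in>T. r b) x = (\<Oplus>\<^bsub>R\<^esub>b\<in>T. r b x)" using T(1) r by (rule finsum_RG_apply)
      also have "\<dots> = (\<Oplus>\<^bsub>R\<^esub>b\<in>T. \<zero>\<^bsub>R\<^esub>)" using n r not_supp by (intro R.finsum_cong') auto
      finally have "(\<Oplus>\<^bsub>RG\<^esub>b\<in>T. r b) x = \<zero>\<^bsub>R\<^esub>" by (simp add: R.finsum_zero)
      then have "y x = \<zero>\<^bsub>R\<^esub>"
        using n fun_cong[OF one, of x] RG_closed[OF yc] by (simp add: add_RG one_RG)
      then show False using x by (simp add: supp_def)
    qed
  qed
  then have "card (supp y) \<le> card (insert \<one>\<^bsub>G\<^esub> (\<Union>b\<in>T. supp (r b)))"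
    using T(1) r finite_supp by (intro card_mono) auto
  also have "\<dots> \<le> Suc (card (\<Union>b\<in>T. supp (r b)))" by (rule card_insert_le_m1) auto
  also have "\<dots> \<le> Suc (\<Sum>b\<in>T. card (supp (r b)))" using card_UN_le[OF T(1)] by simp
  also have "(\<Sum>b\<in>T. card (supp (r b))) \<le> ?N"
    unfolding C_def using T(2)
    by (intro sum_mono card_supp_mult_ind_mult[OF dom _ _ _ spb]) (auto simp: Z r)
  finally have "card (supp y) \<le> Suc ?N" by simp
  moreover have "3 * ?N \<le> card (supp y)"
    unfolding y_def using T(1) Cc sp X disj by (rule card_supp_sum_ind_mult)
  \<comment> \<open>Here \<open>3 * ?N \<le> ?N + 1\<close>. The factor 2 would still admit
    \<open>?N = 1\<close>; this is why each \<open>X b\<close> has five elements.\<close>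
  ultimately have N: "?N = 0" by linarith
  have "r b = \<zero>\<^bsub>RG\<^esub>" if b: "b \<in> T" for b
  proof -
    have "card (supp (r b)) \<le> card (supp (C b))"
      unfolding C_def using T(2) b by (intro card_supp_mult_ind_mult[OF dom _ _ _ spb]) (auto simp: Z r)
    also have "\<dots> = 0" using N T(1) b by simp
    finally show ?thesis using r[OF b] by (simp add: finite_supp supp_empty_iff)
  qed
  then have "?sum = (\<Oplus>\<^bsub>RG\<^esub>b\<in>T. \<zero>\<^bsub>RG\<^esub>)"
    using cl by (intro RG.finsum_cong') auto
  then have "\<one>\<^bsub>RG\<^esub> \<one>\<^bsub>G\<^esub> = \<zero>\<^bsub>RG\<^esub> \<one>\<^bsub>G\<^esub>" using eq by (simp add: RG.finsum_zero)
  then show False using dom by (simp add: one_RG zero_RG noncomm_domain_def)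
qed

section \<open>Cardinality of group rings and choice of the generators\<close>

text \<open>A finitely supported function is determined by a finite set of pairs, and an infinite
  \<open>G\<close> has no more finite sets of pairs from \<open>G\<close> and \<open>D\<close> than
  elements.\<close>

lemma RG_lepoll:
  assumes inf: "infinite (carrier G)" and D: "D \<lesssim> carrier G"
  shows "{f \<in> carrier RG. \<forall>x \<in> carrier G. f x \<in> D} \<lesssim> carrier G"
proof -
  have "{f \<in> carrier RG. \<forall>x \<in> carrier G. f x \<in> D} \<lesssim>
      {f. f ` carrier G \<subseteq> D \<and> {x. f x \<noteq> \<zero>\<^bsub>R\<^esub>} \<subseteq> carrier G \<and> finite {x. f x \<noteq> \<zero>\<^bsub>R\<^esub>}}"
  proof (rule subset_imp_lepoll, clarify, intro conjI)
    fix f assume f: "f \<in> carrier RG"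
    have "{x. f x \<noteq> \<zero>\<^bsub>R\<^esub>} = supp f" using RG_outside[OF f] by (auto simp: supp_def)
    then show "{x. f x \<noteq> \<zero>\<^bsub>R\<^esub>} \<subseteq> carrier G" "finite {x. f x \<noteq> \<zero>\<^bsub>R\<^esub>}"
      using supp_subset finite_supp[OF f] by auto
  qed auto
  also have "\<dots> \<lesssim> Fpow (carrier G \<times> D)" by (rule lepoll_restricted_funspace)
  also have "Fpow (carrier G \<times> D) \<lesssim> Fpow (carrier G)"
    using times_lepoll_infinite[OF inf lepoll_refl D] by (simp add: lepoll_iff_ordLeq card_of_Fpow_mono)
  also have "\<dots> \<lesssim> carrier G" using inf by (rule Fpow_lepoll_infinite)
  finally show ?thesis .
qed

text \<open>Since \<open>T\<close> is no larger than \<open>G\<close> and \<open>U\<close> is at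
  least as large, five copies of \<open>T\<close> embed into \<open>U\<close>. The images of the
  copies of \<open>b\<close> form \<open>X b\<close>, so these sets are disjoint. The sets
  \<open>Z b\<close> depend on \<open>supp b\<close> and are chosen for each \<open>b\<close>
  separately.\<close>

lemma comaximal_elements_exist:
  assumes dom: "noncomm_domain R" and nc: "\<not> comm_group G" and lf: "locally_free_group G"
    and H: "subgroup H G" "free_group (G\<lparr>carrier := H\<rparr>)" "H \<approx> carrier G"
    and T: "T \<subseteq> carrier RG - {\<zero>\<^bsub>RG\<^esub>}" "T \<lesssim> carrier G"
  obtains X Z where "\<And>b. b \<in> T \<Longrightarrow> ind (X b) \<in> carrier RG" "\<And>b. b \<in> T \<Longrightarrow> ind (Z b) \<in> carrier RG"
    "\<And>F r. \<lbrakk>finite F; F \<subseteq> T; \<And>b. b \<in> F \<Longrightarrow> r b \<in> carrier RG\<rbrakk> \<Longrightarrow>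
      (\<Oplus>\<^bsub>RG\<^esub>b\<in>F. (ind (X b) \<otimes>\<^bsub>RG\<^esub> (b \<otimes>\<^bsub>RG\<^esub> ind (Z b)) \<oplus>\<^bsub>RG\<^esub> \<one>\<^bsub>RG\<^esub>) \<otimes>\<^bsub>RG\<^esub> r b) \<noteq> \<one>\<^bsub>RG\<^esub>"
proof -
  obtain U A where U: "carrier G \<lesssim> U" and sp: "spread G {\<one>\<^bsub>G\<^esub>} U A"
    using G.locally_free_large_spread[OF nc lf H] by blast
  \<comment> \<open>With empty \<open>S\<close> the spread family is just an infinite subset of
    \<open>G\<close>.\<close>
  have inf: "infinite (carrier G)"
    using G.locally_free_infinite_spread[OF nc lf, of "{}"] finite_subset by (auto simp: spread_def)
  have "T \<times> {..<5::nat} \<lesssim> carrier G"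
    using inf T(2) by (intro times_lepoll_infinite) (auto intro: countable_lepoll_infinite)
  then have "T \<times> {..<5::nat} \<lesssim> U" using U by (rule lepoll_trans)
  then obtain e where e: "inj_on e (T \<times> {..<5::nat})" "e ` (T \<times> {..<5::nat}) \<subseteq> U"
    by (auto simp: lepoll_def)
  define X where "X b = e ` ({b} \<times> {..<5})" for b
  have "\<forall>b \<in> T. \<exists>Z' A' Z. spread G (supp b) Z' A' \<and> Z \<subseteq> Z' \<and> card Z = 3"
  proof
    fix b assume "b \<in> T"
    then obtain Z' A' where Z': "infinite Z'" "spread G (supp b) Z' A'"
      using G.locally_free_infinite_spread[OF nc lf, of "supp b"] T(1) finite_supp supp_subset by blast
    obtain Z where "Z \<subseteq> Z'" "card Z = 3" using infinite_arbitrarily_large[OF Z'(1), of 3] by blast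
    then show "\<exists>Z' A' Z. spread G (supp b) Z' A' \<and> Z \<subseteq> Z' \<and> card Z = 3" using Z' by blast
  qed
  then obtain Z' A' Z where Z: "\<And>b. b \<in> T \<Longrightarrow> spread G (supp b) (Z' b) (A' b)"
    "\<And>b. b \<in> T \<Longrightarrow> Z b \<subseteq> Z' b" "\<And>b. b \<in> T \<Longrightarrow> card (Z b) = 3"
    by metis
  have XU: "X b \<subseteq> U" if "b \<in> T" for b using e(2) that by (auto simp: X_def)
  have Xcard: "card (X b) = 5" if "b \<in> T" for b
  proof -
    have "inj_on e ({b} \<times> {..<5})" using that by (intro inj_on_subset[OF e(1)]) auto
    then show ?thesis by (simp add: X_def card_image card_cartesian_product)
  qed
  have Xdisj: "b = c" if "b \<in> T" "c \<in> T" "u \<in> X b" "u \<in> X c" for b c u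
    using that e(1) by (auto simp: X_def dest: inj_onD)
  show thesis
  proof
    show "ind (X b) \<in> carrier RG" if "b \<in> T" for b
      using XU[OF that] sp by (intro ind_closed) (auto simp: X_def spread_def)
    show "ind (Z b) \<in> carrier RG" if "b \<in> T" for b
      using Z[OF that] by (intro ind_closed) (auto intro: card_ge_0_finite simp: spread_def)
    fix F r assume F: "finite F" "F \<subseteq> T" and r: "\<And>b. b \<in> F \<Longrightarrow> r b \<in> carrier RG"
    show "(\<Oplus>\<^bsub>RG\<^esub>b\<in>F. (ind (X b) \<otimes>\<^bsub>RG\<^esub> (b \<otimes>\<^bsub>RG\<^esub> ind (Z b)) \<oplus>\<^bsub>RG\<^esub> \<one>\<^bsub>RG\<^esub>) \<otimes>\<^bsub>RG\<^esub> r b) \<noteq> \<one>\<^bsub>RG\<^esub>"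
    proof (rule comaximal_elements_independent[OF dom F(1) _ r sp, where Z' = Z' and A' = A'])
      show "F \<subseteq> carrier RG - {\<zero>\<^bsub>RG\<^esub>}" using F(2) T(1) by (rule subset_trans)
      show "b = c" if "b \<in> F" "c \<in> F" "u \<in> X b" "u \<in> X c" for b c u
        using Xdisj[OF subsetD[OF F(2)] subsetD[OF F(2)]] that .
    qed (assumption | rule XU Xcard Z, erule subsetD[OF F(2)])+
  qed
qed

end

section \<open>Primitivity from a comaximal right ideal\<close>

context ring
begin

definition right_ideal :: "'a set \<Rightarrow> bool" where
  "right_ideal P \<longleftrightarrow> subgroup P (add_monoid R) \<and> (\<forall>p \<in> P. \<forall>a \<in> carrier R. p \<otimes> a \<in> P)"

text \<open>Negatives arise by right multiplication with \<open>\<ominus> \<one>\<close>.\<close>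

lemma right_idealI:
  assumes "P \<subseteq> carrier R" "\<zero> \<in> P" "\<And>p q. p \<in> P \<Longrightarrow> q \<in> P \<Longrightarrow> p \<oplus> q \<in> P"
    "\<And>p a. p \<in> P \<Longrightarrow> a \<in> carrier R \<Longrightarrow> p \<otimes> a \<in> P"
  shows "right_ideal P"
proof -
  have "\<ominus> p \<in> P" if "p \<in> P" for p
    using assms(4)[OF that, of "\<ominus> \<one>"] that assms(1) by (auto simp: r_minus)
  then have "subgroup P (add_monoid R)" using assms by (intro add.subgroupI) auto
  then show ?thesis using assms(4) by (simp add: right_ideal_def)
qed

lemma right_idealD:
  assumes "right_ideal P"
  shows "P \<subseteq> carrier R" "\<zero> \<in> P" "\<And>p q. p \<in> P \<Longrightarrow> q \<in> P \<Longrightarrow> p \<oplus> q \<in> P"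
    "\<And>p a. p \<in> P \<Longrightarrow> a \<in> carrier R \<Longrightarrow> p \<otimes> a \<in> P"
  using assms subgroup.subset[of P "add_monoid R"] subgroup.one_closed[of P "add_monoid R"]
    subgroup.m_closed[of P "add_monoid R"]
  by (auto simp: right_ideal_def)

lemma right_ideal_one: "right_ideal P \<Longrightarrow> \<one> \<in> P \<Longrightarrow> P = carrier R"
  using right_idealD(1,4) by (metis l_one subsetI subset_antisym)

text \<open>Zorn's lemma applies because the union of a chain of right ideals that avoid
  \<open>\<one>\<close> again avoids \<open>\<one>\<close>.\<close>

lemma maximal_right_ideal_exists:
  assumes P: "right_ideal P" "\<one> \<notin> P"
  obtains Q where "right_ideal Q" "P \<subseteq> Q" "\<one> \<notin> Q"
    "\<And>N. right_ideal N \<Longrightarrow> Q \<subseteq> N \<Longrightarrow> \<one> \<notin> N \<Longrightarrow> N = Q"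
proof -
  let ?F = "{Q. right_ideal Q \<and> P \<subseteq> Q \<and> \<one> \<notin> Q}"
  have "\<exists>Q \<in> ?F. \<forall>N \<in> ?F. Q \<subseteq> N \<longrightarrow> N = Q"
  proof (rule subset_Zorn_nonempty)
    show "?F \<noteq> {}" using P by blast
    fix C assume ne: "C \<noteq> {}" and C: "subset.chain ?F C"
    have CF: "C \<subseteq> ?F" and lin: "\<And>A B. A \<in> C \<Longrightarrow> B \<in> C \<Longrightarrow> A \<subseteq> B \<or> B \<subseteq> A"
      using C by (auto simp: subset_chain_def)
    have "right_ideal (\<Union>C)"
    proof (rule right_idealI)
      show "\<Union>C \<subseteq> carrier R" using CF right_idealD(1) by blast
      show "\<zero> \<in> \<Union>C" using ne CF right_idealD(2) by blast
      show "p \<otimes> a \<in> \<Union>C" if "p \<in> \<Union>C" "a \<in> carrier R" for p a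
        using that CF right_idealD(4) by blast
      show "p \<oplus> q \<in> \<Union>C" if pq: "p \<in> \<Union>C" "q \<in> \<Union>C" for p q
      proof -
        obtain A where A: "p \<in> A" "A \<in> C" by (rule UnionE[OF pq(1)])
        obtain B where B: "q \<in> B" "B \<in> C" by (rule UnionE[OF pq(2)])
        obtain D where "D \<in> C" "p \<in> D" "q \<in> D" using lin[OF A(2) B(2)] A B by blast
        moreover from this(1) have "right_ideal D" using CF by blast
        ultimately show ?thesis using right_idealD(3)[of D p q] by blast
      qed
    qed
    then show "\<Union>C \<in> ?F" using CF ne by blast
  qed
  then obtain Q where Q: "Q \<in> ?F" and max: "\<forall>N \<in> ?F. Q \<subseteq> N \<longrightarrow> N = Q" by (rule bexE)
  show thesis
  proof (rule that[of Q])
    fix N assume "right_ideal N" "Q \<subseteq> N" "\<one> \<notin> N"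
    moreover from this Q have "N \<in> ?F" by auto
    ultimately show "N = Q" using max by auto
  qed (use Q in auto)
qed

lemma right_primitive_of_comaximal:
  assumes P: "right_ideal P" "\<one> \<notin> P"
    and comax: "\<And>I. ideal I R \<Longrightarrow> I \<noteq> {\<zero>} \<Longrightarrow> \<exists>p \<in> P. \<exists>i \<in> I. p \<oplus> i = \<one>"
  shows "right_primitive R"
proof -
  obtain Q where Q: "right_ideal Q" "P \<subseteq> Q" "\<one> \<notin> Q"
    and max: "\<And>N. right_ideal N \<Longrightarrow> Q \<subseteq> N \<Longrightarrow> \<one> \<notin> N \<Longrightarrow> N = Q"
    using maximal_right_ideal_exists[OF P] by blast
  note QD = right_idealD[OF Q(1)]
  have sgQ: "subgroup Q (add_monoid R)" using Q(1) by (simp add: right_ideal_def)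
  interpret Q: abelian_subgroup Q R
    by (intro abelian_subgroupI3 additive_subgroup.intro sgQ) unfold_locales
  define M :: "'a set ring" where
    "M = \<lparr>carrier = a_rcosets Q, mult = (\<lambda>x y. x), one = {}, ring.zero = Q, add = set_add R\<rparr>"
  \<comment> \<open>The union avoids choosing a representative of the coset \<open>C\<close>. All
    its members are the same coset, because \<open>Q\<close> absorbs right multiplication.\<close>
  define act where "act C a = (\<Union>c\<in>C. Q +> (c \<otimes> a))" for C a
  have sel: "carrier M = (\<lambda>x. Q +> x) ` carrier R" "\<zero>\<^bsub>M\<^esub> = Q" "\<And>x y. x \<oplus>\<^bsub>M\<^esub> y = x <+> y"
    by (auto simp: M_def A_RCOSETS_def')
  have Q0: "Q +> x = Q \<longleftrightarrow> x \<in> Q" if "x \<in> carrier R" for x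
    using that a_coset_join1[OF _ that sgQ] a_coset_join2[OF that sgQ] by blast
  have add: "(Q +> x) \<oplus>\<^bsub>M\<^esub> (Q +> y) = Q +> (x \<oplus> y)" if "x \<in> carrier R" "y \<in> carrier R" for x y
    using that by (simp add: sel Q.a_rcos_sum)
  have zero: "\<zero>\<^bsub>M\<^esub> = Q +> \<zero>" using Q0[OF zero_closed] QD(2) by (simp add: sel)
  have act: "act (Q +> x) a = Q +> (x \<otimes> a)" if x: "x \<in> carrier R" and a: "a \<in> carrier R" for x a
  proof -
    have "Q +> (c \<otimes> a) = Q +> (x \<otimes> a)" if cQ: "c \<in> Q +> x" for c
    proof -
      obtain q where q: "q \<in> Q" "c = q \<oplus> x" using cQ by (auto simp: a_r_coset_def')
      have qc: "q \<in> carrier R" using q QD(1) by blast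
      have "c \<otimes> a = (q \<otimes> a) \<oplus> (x \<otimes> a)" using q qc x a by (simp add: l_distr)
      then have "c \<otimes> a \<in> Q +> (x \<otimes> a)" using q(1) a QD(4) by (auto simp: a_r_coset_def')
      then show ?thesis using a_repr_independence[OF _ _ sgQ] x a by simp
    qed
    then show ?thesis
      unfolding act_def using Q.a_rcos_self[OF x] by (intro UN_constant_eq ballI)
  qed
  have ab: "abelian_group M"
  proof (rule abelian_groupI)
    show "\<exists>y \<in> carrier M. y \<oplus>\<^bsub>M\<^esub> x = \<zero>\<^bsub>M\<^esub>" if xM: "x \<in> carrier M" for x
    proof -
      obtain u where u: "u \<in> carrier R" "x = Q +> u" using xM by (auto simp: sel(1))
      then have "(Q +> (\<ominus> u)) \<oplus>\<^bsub>M\<^esub> x = \<zero>\<^bsub>M\<^esub>" by (simp add: add zero l_neg)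
      then show ?thesis using u(1) by (auto simp: sel(1))
    qed
  qed (auto simp: sel(1) zero add a_ac)
  have rm: "right_module R M act"
    unfolding right_module_def right_module_axioms_def
    by (auto simp: ab ring_axioms sel(1) act add l_distr r_distr m_assoc)
  have "irreducible_right_module R M act"
    unfolding irreducible_right_module_def
  proof (intro conjI allI impI rm)
    have "Q +> \<one> \<in> carrier M" "Q +> \<one> \<noteq> \<zero>\<^bsub>M\<^esub>" using Q0 Q(3) by (auto simp: sel)
    then show "carrier M \<noteq> {\<zero>\<^bsub>M\<^esub>}" by blast
    fix N assume N: "right_submodule N R M act"
    then have sgN: "subgroup N (add_monoid M)"
      and clN: "\<And>C a. C \<in> N \<Longrightarrow> a \<in> carrier R \<Longrightarrow> act C a \<in> N"
      by (auto simp: right_submodule_def)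
    have NM: "N \<subseteq> carrier M" using subgroup.subset[OF sgN] by simp
    \<comment> \<open>The preimage of a submodule in \<open>R\<close> is a right ideal containing
      \<open>Q\<close>. By maximality it is \<open>Q\<close>, or it contains \<open>\<one>\<close>
      and is all of \<open>R\<close>.\<close>
    define N' where "N' = {x \<in> carrier R. Q +> x \<in> N}"
    have NN: "N = (\<lambda>x. Q +> x) ` N'" using NM by (auto simp: N'_def sel(1))
    have N': "right_ideal N'"
    proof (rule right_idealI)
      show "\<zero> \<in> N'" using subgroup.one_closed[OF sgN] by (simp add: N'_def zero)
      show "p \<oplus> q \<in> N'" if "p \<in> N'" "q \<in> N'" for p q
        using subgroup.m_closed[OF sgN, of "Q +> p" "Q +> q"] that by (simp add: N'_def add)
      show "p \<otimes> a \<in> N'" if "p \<in> N'" "a \<in> carrier R" for p a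
        using clN[of "Q +> p" a] that by (simp add: N'_def act)
    qed (auto simp: N'_def)
    have QN: "Q \<subseteq> N'"
    proof
      fix q assume "q \<in> Q"
      then have "q \<in> carrier R" "Q +> q = \<zero>\<^bsub>M\<^esub>" using QD(1) Q0 by (auto simp: sel)
      then show "q \<in> N'" using subgroup.one_closed[OF sgN] by (simp add: N'_def)
    qed
    show "N = {\<zero>\<^bsub>M\<^esub>} \<or> N = carrier M"
    proof (cases "\<one> \<in> N'")
      case True
      then have "N' = carrier R" using right_ideal_one[OF N'] by simp
      then show ?thesis using NN by (simp add: sel(1))
    next
      case False
      then have "N' = Q" using max[OF N' QN] by simp
      then have "N = (\<lambda>x. Q +> x) ` Q" using NN by simp
      also have "\<dots> = (\<lambda>x. Q) ` Q" using QD(1) Q0 by (intro image_cong) auto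
      also have "\<dots> = {\<zero>\<^bsub>M\<^esub>}" using image_constant[OF QD(2)] by (simp add: sel(2))
      finally show ?thesis ..
    qed
  qed
  moreover have "faithful_right_module R M act"
    unfolding faithful_right_module_def
  proof (intro conjI rm)
    \<comment> \<open>\<open>?A\<close> is the annihilator of the module. It is a two-sided ideal,
      and taking \<open>x = \<one>\<close> shows that it lies in \<open>Q\<close>. Were it nonzero,
      comaximality with \<open>P \<subseteq> Q\<close> would put \<open>\<one>\<close> into
      \<open>Q\<close>.\<close>
    let ?A = "{a \<in> carrier R. \<forall>x \<in> carrier R. x \<otimes> a \<in> Q}"
    have "ideal ?A R"
    proof (rule idealI)
      have "right_ideal ?A"
        using QD by (intro right_idealI) (auto simp: r_distr simp flip: m_assoc)
      then show "subgroup ?A (add_monoid R)" by (simp add: right_ideal_def)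
    qed (use QD in \<open>auto simp: ring_axioms simp flip: m_assoc\<close>)
    moreover have "\<not> (\<exists>p \<in> P. \<exists>i \<in> ?A. p \<oplus> i = \<one>)"
    proof clarify
      fix p i assume *: "p \<in> P" "i \<in> carrier R" "\<forall>x \<in> carrier R. x \<otimes> i \<in> Q" "p \<oplus> i = \<one>"
      have "\<one> \<otimes> i \<in> Q" using * by blast
      then have "i \<in> Q" using *(2) by simp
      then have "p \<oplus> i \<in> Q" using *(1) Q(2) QD(3) by blast
      then show False using * Q(3) by simp
    qed
    ultimately have A: "?A = {\<zero>}" using comax by blast
    show "\<forall>a \<in> carrier R. (\<forall>x \<in> carrier M. act x a = \<zero>\<^bsub>M\<^esub>) \<longrightarrow> a = \<zero>"
    proof (intro ballI impI)
      fix a assume a: "a \<in> carrier R" "\<forall>x \<in> carrier M. act x a = \<zero>\<^bsub>M\<^esub>"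
      have "x \<otimes> a \<in> Q" if "x \<in> carrier R" for x
        using a that Q0[of "x \<otimes> a"] by (auto simp: sel(1,2) act)
      then show "a = \<zero>" using A a(1) by blast
    qed
  qed
  ultimately show ?thesis by (rule right_primitiveI)
qed

text \<open>Elements are written with one coefficient for each \<open>b\<close> in a finite subset
  of \<open>T\<close>, the form of sum that the independence statement excludes from being
  1.\<close>

lemma right_ideal_generated:
  assumes T: "\<And>b. b \<in> T \<Longrightarrow> e b \<in> carrier R"
  defines "P \<equiv> {\<Oplus>b\<in>F. e b \<otimes> r b |F r. finite F \<and> F \<subseteq> T \<and> (\<forall>b \<in> F. r b \<in> carrier R)}"
  shows "right_ideal P" "\<And>b. b \<in> T \<Longrightarrow> e b \<in> P"
proof -
  have mem: "(\<Oplus>b\<in>F. e b \<otimes> r b) \<in> P" if "finite F" "F \<subseteq> T" "\<And>b. b \<in> F \<Longrightarrow> r b \<in> carrier R" for F r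
    using that unfolding P_def by blast
  show "e b \<in> P" if "b \<in> T" for b
    using mem[of "{b}" "\<lambda>_. \<one>"] that T by simp
  show "right_ideal P"
  proof (rule right_idealI)
    show "P \<subseteq> carrier R" unfolding P_def using T by (auto intro!: finsum_closed)
    show "\<zero> \<in> P" using mem[of "{}"] by simp
  next
    fix p a assume "p \<in> P" and a: "a \<in> carrier R"
    then obtain F r where p: "p = (\<Oplus>b\<in>F. e b \<otimes> r b)" and F: "finite F" "F \<subseteq> T" "\<forall>b \<in> F. r b \<in> carrier R"
      by (auto simp: P_def)
    have "p \<otimes> a = (\<Oplus>b\<in>F. e b \<otimes> r b \<otimes> a)"
      unfolding p using F T a by (intro finsum_ldistr) auto
    also have "\<dots> = (\<Oplus>b\<in>F. e b \<otimes> (r b \<otimes> a))"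
      using F T a by (intro finsum_cong') (auto simp: m_assoc)
    finally show "p \<otimes> a \<in> P" using F a by (auto intro: mem)
  next
    fix p q assume "p \<in> P" "q \<in> P"
    then obtain F r F' r' where p: "p = (\<Oplus>b\<in>F. e b \<otimes> r b)" and F: "finite F" "F \<subseteq> T" "\<forall>b \<in> F. r b \<in> carrier R"
      and q: "q = (\<Oplus>b\<in>F'. e b \<otimes> r' b)" and F': "finite F'" "F' \<subseteq> T" "\<forall>b \<in> F'. r' b \<in> carrier R"
      by (auto simp: P_def)
    \<comment> \<open>Extension by zero brings both sums to the common index set
      \<open>F \<union> F'\<close>.\<close>
    define s where "s b = (if b \<in> F then r b else \<zero>)" for b
    define s' where "s' b = (if b \<in> F' then r' b else \<zero>)" for b
    have sc: "s b \<in> carrier R" "s' b \<in> carrier R" for b using F F' by (auto simp: s_def s'_def)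
    have Te: "b \<in> F \<union> F' \<Longrightarrow> e b \<in> carrier R" for b using F F' T by auto
    have "p = (\<Oplus>b\<in>F \<union> F'. e b \<otimes> s b)"
      unfolding p using F F' Te by (intro add.finprod_mono_neutral_cong_left) (auto simp: s_def)
    moreover have "q = (\<Oplus>b\<in>F \<union> F'. e b \<otimes> s' b)"
      unfolding q using F F' Te by (intro add.finprod_mono_neutral_cong_left) (auto simp: s'_def)
    ultimately have "p \<oplus> q = (\<Oplus>b\<in>F \<union> F'. e b \<otimes> s b \<oplus> e b \<otimes> s' b)"
      using sc Te by (simp add: finsum_addf Pi_iff)
    also have "\<dots> = (\<Oplus>b\<in>F \<union> F'. e b \<otimes> (s b \<oplus> s' b))"
      using sc Te by (intro finsum_cong') (auto simp: r_distr)
    finally show "p \<oplus> q \<in> P" using F F' sc by (auto intro: mem)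
  qed
qed

end

text \<open>The right ideal is generated by the elements \<open>e b = d b + 1\<close>. It omits 1 by
  independence, and an ideal containing \<open>b \<in> T\<close> also contains \<open>d b\<close>,
  so \<open>e b - d b = 1\<close> shows comaximality.\<close>

lemma (in group_ring_context) right_primitive_group_ring:
  assumes dom: "noncomm_domain R" and nc: "\<not> comm_group G" and lf: "locally_free_group G"
    and H: "subgroup H G" "free_group (G\<lparr>carrier := H\<rparr>)" "H \<approx> carrier G"
    and T: "T \<subseteq> carrier RG - {\<zero>\<^bsub>RG\<^esub>}" "T \<lesssim> carrier G"
    and meets: "\<And>I. ideal I RG \<Longrightarrow> I \<noteq> {\<zero>\<^bsub>RG\<^esub>} \<Longrightarrow> I \<inter> T \<noteq> {}"
  shows "right_primitive RG"
proof -
  obtain X Z where X: "\<And>b. b \<in> T \<Longrightarrow> ind (X b) \<in> carrier RG" and Z: "\<And>b. b \<in> T \<Longrightarrow> ind (Z b) \<in> carrier RG"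
    and indep: "\<And>F r. \<lbrakk>finite F; F \<subseteq> T; \<And>b. b \<in> F \<Longrightarrow> r b \<in> carrier RG\<rbrakk> \<Longrightarrow>
      (\<Oplus>\<^bsub>RG\<^esub>b\<in>F. (ind (X b) \<otimes>\<^bsub>RG\<^esub> (b \<otimes>\<^bsub>RG\<^esub> ind (Z b)) \<oplus>\<^bsub>RG\<^esub> \<one>\<^bsub>RG\<^esub>) \<otimes>\<^bsub>RG\<^esub> r b) \<noteq> \<one>\<^bsub>RG\<^esub>"
    by (rule comaximal_elements_exist[OF dom nc lf H T]) blast
  define d where "d b = ind (X b) \<otimes>\<^bsub>RG\<^esub> (b \<otimes>\<^bsub>RG\<^esub> ind (Z b))" for b
  define e where "e b = d b \<oplus>\<^bsub>RG\<^esub> \<one>\<^bsub>RG\<^esub>" for b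
  have bc: "b \<in> carrier RG" if "b \<in> T" for b using T(1) that by auto
  have dc: "d b \<in> carrier RG" if "b \<in> T" for b using that X Z bc by (simp add: d_def)
  have ec: "e b \<in> carrier RG" if "b \<in> T" for b using dc[OF that] by (simp add: e_def)
  note P = RG.right_ideal_generated[where T = T and e = e, OF ec]
  show ?thesis
  proof (rule RG.right_primitive_of_comaximal[OF P(1)])
    show "\<one>\<^bsub>RG\<^esub> \<notin> {\<Oplus>\<^bsub>RG\<^esub>b\<in>F. e b \<otimes>\<^bsub>RG\<^esub> r b |F r. finite F \<and> F \<subseteq> T \<and> (\<forall>b\<in>F. r b \<in> carrier RG)}"
      (is "_ \<notin> ?P")
      using indep unfolding e_def d_def by force
    fix I assume I: "ideal I RG" "I \<noteq> {\<zero>\<^bsub>RG\<^esub>}"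
    then obtain b where b: "b \<in> I" "b \<in> T" using meets by blast
    interpret I: ideal I RG by fact
    have "d b \<in> I" unfolding d_def using b X Z by (intro I.I_l_closed I.I_r_closed)
    then have "\<ominus>\<^bsub>RG\<^esub> d b \<in> I" by simp
    moreover have "e b \<oplus>\<^bsub>RG\<^esub> (\<ominus>\<^bsub>RG\<^esub> d b) = \<one>\<^bsub>RG\<^esub>"
      using dc[OF b(2)] by (simp add: e_def RG.a_comm[of "d b"] RG.a_assoc RG.r_neg)
    moreover have "e b \<in> ?P" using P(2) b(2) by blast
    ultimately show "\<exists>p\<in>?P. \<exists>i\<in>I. p \<oplus>\<^bsub>RG\<^esub> i = \<one>\<^bsub>RG\<^esub>" by blast
  qed
qed

section \<open>Ideals of group rings over fields\<close>

lemma (in ring) finsum_subring_closed: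
  assumes D: "subring D R" and "finite A" and "\<And>x. x \<in> A \<Longrightarrow> f x \<in> D"
  shows "finsum R f A \<in> D"
  using assms(2,3)
proof (induction A)
  case empty
  then show ?case using subringE(2)[OF D] by simp
next
  case (insert a A)
  then have "f x \<in> carrier R" if "x \<in> insert a A" for x
    using subringE(1)[OF D] that by blast
  then have "finsum R f (insert a A) = f a \<oplus> finsum R f A"
    using insert.hyps by (simp add: Pi_iff)
  then show ?case using insert subringE(7)[OF D] by simp
qed

lemma (in ring) add_minus_add:
  assumes "p \<in> carrier R" "p' \<in> carrier R" "q \<in> carrier R" "q' \<in> carrier R"
  shows "(p \<oplus> q) \<ominus> (p' \<oplus> q') = (p \<ominus> p') \<oplus> (q \<ominus> q')"
  using assms by (simp add: minus_eq minus_add a_ac)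

context group_ring_context
begin

text \<open>For a subring \<open>D\<close> this is the group ring of \<open>G\<close> over
  \<open>D\<close>, seen inside the one over \<open>R\<close>.\<close>

definition coeff_ring :: "'r set \<Rightarrow> ('g \<Rightarrow> 'r) set" where
  "coeff_ring D = {f \<in> carrier RG. \<forall>x \<in> carrier G. f x \<in> D}"

lemma coeff_ring_apply: "subring D R \<Longrightarrow> f \<in> coeff_ring D \<Longrightarrow> f x \<in> D"
  using RG_outside[of f x] subringE(2)[of D R] by (cases "x \<in> carrier G") (auto simp: coeff_ring_def)

lemma minus_RG_apply:
  assumes "f \<in> carrier RG" shows "(\<ominus>\<^bsub>RG\<^esub> f) x = \<ominus>\<^bsub>R\<^esub> f x"
proof -
  have "(\<ominus>\<^bsub>RG\<^esub> f \<oplus>\<^bsub>RG\<^esub> f) x = \<zero>\<^bsub>R\<^esub>" using assms by (simp add: RG.l_neg zero_RG)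
  then have "(\<ominus>\<^bsub>RG\<^esub> f) x \<oplus>\<^bsub>R\<^esub> f x = \<zero>\<^bsub>R\<^esub>" by (simp add: add_RG)
  then show ?thesis using assms RG_closed[of "\<ominus>\<^bsub>RG\<^esub> f" x] RG_closed[of f x] by (simp add: R.minus_equality)
qed

lemma coeff_ring_subring:
  assumes D: "subring D R" shows "subring (coeff_ring D) RG"
proof (rule RG.subringI)
  show "coeff_ring D \<subseteq> carrier RG" by (auto simp: coeff_ring_def)
  show "\<one>\<^bsub>RG\<^esub> \<in> coeff_ring D" using subringE(2,3)[OF D] by (auto simp: coeff_ring_def one_RG[symmetric]) (simp add: one_RG)
  show "\<ominus>\<^bsub>RG\<^esub> f \<in> coeff_ring D" if "f \<in> coeff_ring D" for f
    using that subringE(5)[OF D] by (auto simp: coeff_ring_def minus_RG_apply)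
  fix f h assume fh: "f \<in> coeff_ring D" "h \<in> coeff_ring D"
  then have c: "f \<in> carrier RG" "h \<in> carrier RG" by (auto simp: coeff_ring_def)
  show "f \<oplus>\<^bsub>RG\<^esub> h \<in> coeff_ring D"
    using fh subringE(7)[OF D] c by (simp add: coeff_ring_def) (simp add: add_RG)
  have "(f \<otimes>\<^bsub>RG\<^esub> h) x \<in> D" if "x \<in> carrier G" for x
    unfolding mult_RG[OF c that finite_supp[OF c(1)] subset_refl]
    using c coeff_ring_apply[OF D fh(1)] coeff_ring_apply[OF D fh(2)]
    by (intro R.finsum_subring_closed[OF D] finite_supp subringE(6)[OF D])
  then show "f \<otimes>\<^bsub>RG\<^esub> h \<in> coeff_ring D" using c by (simp add: coeff_ring_def)
qed

text \<open>Combinations of \<open>n\<close> elements with coefficients in \<open>D\<close>, the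
  scalars being taken from all of \<open>R\<close>; \<open>n\<close> is the length on which the
  later descent runs. Scalars enter as monomials at the identity, so that they can be moved by the
  ring laws of \<open>RG\<close>.\<close>

primrec span :: "'r set \<Rightarrow> nat \<Rightarrow> ('g \<Rightarrow> 'r) set" where
  "span D 0 = {\<zero>\<^bsub>RG\<^esub>}"
| "span D (Suc n) = {monom k \<one>\<^bsub>G\<^esub> \<otimes>\<^bsub>RG\<^esub> f \<oplus>\<^bsub>RG\<^esub> a |k f a.
     k \<in> carrier R \<and> f \<in> coeff_ring D \<and> a \<in> span D n}"

lemma span_closed: "a \<in> span D n \<Longrightarrow> a \<in> carrier RG"
  by (induction n arbitrary: a) (auto simp: coeff_ring_def monom_closed)

lemma monom_one_mult:
  assumes "c \<in> carrier R" "f \<in> carrier RG"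
  shows "(monom c \<one>\<^bsub>G\<^esub> \<otimes>\<^bsub>RG\<^esub> f) x = c \<otimes>\<^bsub>R\<^esub> f x"
  using assms RG_outside[OF assms(2), of x]
  by (cases "x \<in> carrier G") (simp_all add: monom_mult mult_RG_outside)

text \<open>Induction on a finite set containing the support: one point \<open>s\<close> is split
  off as the scalar \<open>f s\<close> times the group element \<open>s\<close>, whose coefficients
  0 and 1 lie in \<open>D\<close>.\<close>

lemma span_exhaustive:
  assumes D: "subring D R"
  shows "f \<in> carrier RG \<Longrightarrow> \<exists>n. f \<in> span D n"
proof -
  have "\<exists>n. f \<in> span D n" if "finite S" "f \<in> carrier RG" "supp f \<subseteq> S" for S f
    using that
  proof (induction S arbitrary: f)
    case empty
    then have "f \<in> span D 0" by (simp add: supp_empty_iff)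
    then show ?case ..
  next
    case (insert s S)
    note f = insert.prems(1)
    show ?case
    proof (cases "s \<in> carrier G")
      case False
      then have "supp f \<subseteq> S" using insert.prems(2) supp_subset by blast
      then show ?thesis using insert.IH f by blast
    next
      case s: True
      let ?h = "f(s := \<zero>\<^bsub>R\<^esub>)"
      have sub: "supp ?h \<subseteq> supp f" "supp ?h \<subseteq> S" using insert.prems(2) by (auto simp: supp_def)
      have h: "?h \<in> carrier RG"
        using f sub(1) finite_subset[OF sub(1) finite_supp[OF f]] by (simp add: carrier_RG)
      then obtain n where n: "?h \<in> span D n" using insert.IH sub by blast
      have m: "monom \<one>\<^bsub>R\<^esub> s \<in> carrier RG" using s by (simp add: monom_closed)
      have "f = monom (f s) \<one>\<^bsub>G\<^esub> \<otimes>\<^bsub>RG\<^esub> monom \<one>\<^bsub>R\<^esub> s \<oplus>\<^bsub>RG\<^esub> ?h"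
      proof
        fix x
        have e: "(monom (f s) \<one>\<^bsub>G\<^esub> \<otimes>\<^bsub>RG\<^esub> monom \<one>\<^bsub>R\<^esub> s) x = f s \<otimes>\<^bsub>R\<^esub> monom \<one>\<^bsub>R\<^esub> s x"
          by (rule monom_one_mult[OF RG_closed[OF f] m])
        show "f x = (monom (f s) \<one>\<^bsub>G\<^esub> \<otimes>\<^bsub>RG\<^esub> monom \<one>\<^bsub>R\<^esub> s \<oplus>\<^bsub>RG\<^esub> ?h) x"
          using RG_closed[OF f] by (simp only: add_RG e) (simp add: monom_def)
      qed
      moreover have "monom \<one>\<^bsub>R\<^esub> s \<in> coeff_ring D"
        using m subringE(2,3)[OF D] by (simp add: coeff_ring_def monom_def)
      ultimately have "f \<in> span D (Suc n)" using f n RG_closed by fastforce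
      then show ?thesis ..
    qed
  qed
  then show "f \<in> carrier RG \<Longrightarrow> \<exists>n. f \<in> span D n" using finite_supp by blast
qed

text \<open>Multiplying by a generic \<open>z\<close> in the middle leaves no cancellation between the products
  \<open>s z t\<close>, so the coefficients of \<open>a z f\<close> are the products of those of \<open>a\<close> and \<open>f\<close>.\<close>

lemma mult_generic_monom:
  assumes a: "a \<in> carrier RG" and f: "f \<in> carrier RG" and z: "z \<in> carrier G"
    and S: "S \<subseteq> carrier G" "supp a \<subseteq> S" "supp f \<subseteq> S" and s: "s \<in> S" and t: "t \<in> S"
    and inj: "\<And>s t s' t'. \<lbrakk>s \<in> S; t \<in> S; s' \<in> S; t' \<in> S; s \<otimes>\<^bsub>G\<^esub> (z \<otimes>\<^bsub>G\<^esub> t) = s' \<otimes>\<^bsub>G\<^esub> (z \<otimes>\<^bsub>G\<^esub> t')\<rbrakk> \<Longrightarrow> s = s' \<and> t = t'"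
  shows "(a \<otimes>\<^bsub>RG\<^esub> (monom \<one>\<^bsub>R\<^esub> z \<otimes>\<^bsub>RG\<^esub> f)) (s \<otimes>\<^bsub>G\<^esub> (z \<otimes>\<^bsub>G\<^esub> t)) = a s \<otimes>\<^bsub>R\<^esub> f t"
proof -
  let ?x = "s \<otimes>\<^bsub>G\<^esub> (z \<otimes>\<^bsub>G\<^esub> t)"
  have cl: "s \<in> carrier G" "t \<in> carrier G" using s t S by auto
  have mz: "monom \<one>\<^bsub>R\<^esub> z \<in> carrier RG" using z by (simp add: monom_closed)
  have x: "?x \<in> carrier G" using cl z by simp
  have fin: "finite (insert s (supp a))" using finite_supp[OF a] by simp
  have mv: "(monom \<one>\<^bsub>R\<^esub> z \<otimes>\<^bsub>RG\<^esub> f) y = f (inv\<^bsub>G\<^esub> z \<otimes>\<^bsub>G\<^esub> y)" if "y \<in> carrier G" for y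
    using monom_mult[OF R.one_closed z f that] RG_closed[OF f] by simp
  have "(a \<otimes>\<^bsub>RG\<^esub> (monom \<one>\<^bsub>R\<^esub> z \<otimes>\<^bsub>RG\<^esub> f)) ?x =
      (\<Oplus>\<^bsub>R\<^esub>y\<in>insert s (supp a). a y \<otimes>\<^bsub>R\<^esub> (monom \<one>\<^bsub>R\<^esub> z \<otimes>\<^bsub>RG\<^esub> f) (inv\<^bsub>G\<^esub> y \<otimes>\<^bsub>G\<^esub> ?x))"
    using a f mz x fin by (intro mult_RG) auto
  also have "\<dots> = a s \<otimes>\<^bsub>R\<^esub> (monom \<one>\<^bsub>R\<^esub> z \<otimes>\<^bsub>RG\<^esub> f) (inv\<^bsub>G\<^esub> s \<otimes>\<^bsub>G\<^esub> ?x)"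
  proof (rule R.finsum_eq_single[OF fin])
    fix y assume y: "y \<in> insert s (supp a)" "y \<noteq> s"
    then have yS: "y \<in> S" and yc: "y \<in> carrier G" using S by auto
    let ?h = "inv\<^bsub>G\<^esub> z \<otimes>\<^bsub>G\<^esub> (inv\<^bsub>G\<^esub> y \<otimes>\<^bsub>G\<^esub> ?x)"
    have "?h \<notin> supp f"
    proof
      assume "?h \<in> supp f"
      moreover have "y \<otimes>\<^bsub>G\<^esub> (z \<otimes>\<^bsub>G\<^esub> ?h) = ?x"
      proof -
        have "z \<otimes>\<^bsub>G\<^esub> ?h = inv\<^bsub>G\<^esub> y \<otimes>\<^bsub>G\<^esub> ?x"
          using yc z x by (simp add: G.m_assoc[symmetric, of z "inv\<^bsub>G\<^esub> z"])
        then show ?thesis using yc x by (simp add: G.m_assoc[symmetric, of y "inv\<^bsub>G\<^esub> y"])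
      qed
      ultimately show False using inj[OF yS _ s t, of ?h] S y(2) by blast
    qed
    then have "f ?h = \<zero>\<^bsub>R\<^esub>" using not_supp[OF f] by blast
    then show "a y \<otimes>\<^bsub>R\<^esub> (monom \<one>\<^bsub>R\<^esub> z \<otimes>\<^bsub>RG\<^esub> f) (inv\<^bsub>G\<^esub> y \<otimes>\<^bsub>G\<^esub> ?x) = \<zero>\<^bsub>R\<^esub>"
      using mv[of "inv\<^bsub>G\<^esub> y \<otimes>\<^bsub>G\<^esub> ?x"] yc x RG_closed[OF a] by simp
  qed (use RG_closed[OF a] RG_closed[OF RG.m_closed[OF mz f]] in auto)
  also have "inv\<^bsub>G\<^esub> s \<otimes>\<^bsub>G\<^esub> ?x = z \<otimes>\<^bsub>G\<^esub> t" using cl z by (simp flip: G.m_assoc)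
  also have "(monom \<one>\<^bsub>R\<^esub> z \<otimes>\<^bsub>RG\<^esub> f) (z \<otimes>\<^bsub>G\<^esub> t) = f t"
    using mv[of "z \<otimes>\<^bsub>G\<^esub> t"] cl z by (simp flip: G.m_assoc)
  finally show ?thesis .
qed

text \<open>Each element of the finite set \<open>S\<close> is bad for at most one member of the
  infinite family \<open>Z\<close>. By pigeonhole some \<open>z\<close> is good for all of
  \<open>S\<close>.\<close>

lemma generic_element_exists:
  assumes nc: "\<not> comm_group G" and lf: "locally_free_group G" and S: "finite S" "S \<subseteq> carrier G"
  obtains z where "z \<in> carrier G"
    "\<And>s t s' t'. \<lbrakk>s \<in> S; t \<in> S; s' \<in> S; t' \<in> S; s \<otimes>\<^bsub>G\<^esub> (z \<otimes>\<^bsub>G\<^esub> t) = s' \<otimes>\<^bsub>G\<^esub> (z \<otimes>\<^bsub>G\<^esub> t')\<rbrakk> \<Longrightarrow> s = s' \<and> t = t'"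
proof -
  obtain Z A where Z: "infinite Z" and sp: "spread G S Z A"
    using G.locally_free_infinite_spread[OF nc lf S] by blast
  have "\<exists>z \<in> Z. S \<subseteq> A z"
  proof (rule ccontr)
    assume "\<not> ?thesis"
    then have "\<forall>z \<in> Z. \<exists>g. g \<in> S \<and> g \<notin> A z" by blast
    from bchoice[OF this] obtain c where c: "\<And>z. z \<in> Z \<Longrightarrow> c z \<in> S \<and> c z \<notin> A z" by blast
    have "inj_on c Z"
    proof (rule inj_onI)
      fix u v assume uv: "u \<in> Z" "v \<in> Z" "c u = c v"
      show "u = v"
        by (rule spread_miss[OF sp _ uv(1,2), of "c u"]) (use c[OF uv(1)] c[OF uv(2)] uv(3) S in auto)
    qed
    then have "finite Z" using c S(1) by (intro inj_on_finite[of c Z S]) auto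
    then show False using Z by simp
  qed
  then obtain z where z: "z \<in> Z" "S \<subseteq> A z" by blast
  show thesis
  proof (rule that[of z])
    show "z \<in> carrier G" using z(1) spread_carrier[OF sp] by blast
    fix s t s' t' assume *: "s \<in> S" "t \<in> S" "s' \<in> S" "t' \<in> S" "s \<otimes>\<^bsub>G\<^esub> (z \<otimes>\<^bsub>G\<^esub> t) = s' \<otimes>\<^bsub>G\<^esub> (z \<otimes>\<^bsub>G\<^esub> t')"
    show "s = s' \<and> t = t'"
      using spread_inject[OF sp *(1) z(1) _ _ *(3) z(1) _ _ *(5)] *(2,4) z(2) S(2) by blast
  qed
qed

lemma monom_central:
  assumes "cring R" "k \<in> carrier R" "f \<in> carrier RG"
  shows "f \<otimes>\<^bsub>RG\<^esub> monom k \<one>\<^bsub>G\<^esub> = monom k \<one>\<^bsub>G\<^esub> \<otimes>\<^bsub>RG\<^esub> f"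
proof -
  interpret cring R by fact
  have m: "monom k \<one>\<^bsub>G\<^esub> \<in> carrier RG" using assms by (simp add: monom_closed)
  show ?thesis
  proof (rule RG_eqI[OF RG.m_closed[OF assms(3) m] RG.m_closed[OF m assms(3)]])
    fix x assume "x \<in> carrier G"
    then show "(f \<otimes>\<^bsub>RG\<^esub> monom k \<one>\<^bsub>G\<^esub>) x = (monom k \<one>\<^bsub>G\<^esub> \<otimes>\<^bsub>RG\<^esub> f) x"
      using mult_monom[OF assms(2) G.one_closed assms(3)] monom_one_mult[OF assms(2,3)]
        RG_closed[OF assms(3)] assms(2) by (simp add: m_comm)
  qed
qed

text \<open>In \<open>(k f + a) x g - g x (k f + a)\<close> the contribution of the first summand is
  \<open>k (f x g - g x f)\<close>; it vanishes if \<open>g = f\<close>, which shortens the representation.\<close>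

lemma commutator_split:
  assumes R: "cring R" and k: "k \<in> carrier R"
    and c: "f \<in> carrier RG" "a \<in> carrier RG" "g \<in> carrier RG" "x \<in> carrier RG"
  shows "(monom k \<one>\<^bsub>G\<^esub> \<otimes>\<^bsub>RG\<^esub> f \<oplus>\<^bsub>RG\<^esub> a) \<otimes>\<^bsub>RG\<^esub> (x \<otimes>\<^bsub>RG\<^esub> g) \<ominus>\<^bsub>RG\<^esub> g \<otimes>\<^bsub>RG\<^esub> (x \<otimes>\<^bsub>RG\<^esub> (monom k \<one>\<^bsub>G\<^esub> \<otimes>\<^bsub>RG\<^esub> f \<oplus>\<^bsub>RG\<^esub> a)) =
     monom k \<one>\<^bsub>G\<^esub> \<otimes>\<^bsub>RG\<^esub> (f \<otimes>\<^bsub>RG\<^esub> (x \<otimes>\<^bsub>RG\<^esub> g) \<ominus>\<^bsub>RG\<^esub> g \<otimes>\<^bsub>RG\<^esub> (x \<otimes>\<^bsub>RG\<^esub> f)) \<oplus>\<^bsub>RG\<^esub>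
     (a \<otimes>\<^bsub>RG\<^esub> (x \<otimes>\<^bsub>RG\<^esub> g) \<ominus>\<^bsub>RG\<^esub> g \<otimes>\<^bsub>RG\<^esub> (x \<otimes>\<^bsub>RG\<^esub> a))"
proof -
  let ?k = "monom k \<one>\<^bsub>G\<^esub>"
  have kc: "?k \<in> carrier RG" using k by (simp add: monom_closed)
  have 1: "(?k \<otimes>\<^bsub>RG\<^esub> f \<oplus>\<^bsub>RG\<^esub> a) \<otimes>\<^bsub>RG\<^esub> (x \<otimes>\<^bsub>RG\<^esub> g) =
      ?k \<otimes>\<^bsub>RG\<^esub> (f \<otimes>\<^bsub>RG\<^esub> (x \<otimes>\<^bsub>RG\<^esub> g)) \<oplus>\<^bsub>RG\<^esub> a \<otimes>\<^bsub>RG\<^esub> (x \<otimes>\<^bsub>RG\<^esub> g)"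
    using kc c by (simp add: RG.l_distr RG.m_assoc)
  have "g \<otimes>\<^bsub>RG\<^esub> x \<otimes>\<^bsub>RG\<^esub> (?k \<otimes>\<^bsub>RG\<^esub> f) = ?k \<otimes>\<^bsub>RG\<^esub> (g \<otimes>\<^bsub>RG\<^esub> x) \<otimes>\<^bsub>RG\<^esub> f"
    using monom_central[OF R k, of "g \<otimes>\<^bsub>RG\<^esub> x"] kc c by (simp add: RG.m_assoc[symmetric])
  then have 2: "g \<otimes>\<^bsub>RG\<^esub> (x \<otimes>\<^bsub>RG\<^esub> (?k \<otimes>\<^bsub>RG\<^esub> f \<oplus>\<^bsub>RG\<^esub> a)) =
      ?k \<otimes>\<^bsub>RG\<^esub> (g \<otimes>\<^bsub>RG\<^esub> (x \<otimes>\<^bsub>RG\<^esub> f)) \<oplus>\<^bsub>RG\<^esub> g \<otimes>\<^bsub>RG\<^esub> (x \<otimes>\<^bsub>RG\<^esub> a)"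
    using kc c by (simp add: RG.r_distr RG.m_assoc)
  have 3: "?k \<otimes>\<^bsub>RG\<^esub> (p \<ominus>\<^bsub>RG\<^esub> q) = ?k \<otimes>\<^bsub>RG\<^esub> p \<ominus>\<^bsub>RG\<^esub> ?k \<otimes>\<^bsub>RG\<^esub> q" if "p \<in> carrier RG" "q \<in> carrier RG" for p q
    using that kc by (simp add: RG.minus_eq RG.r_distr RG.r_minus)
  show ?thesis unfolding 1 2 using kc c by (simp add: 3 RG.add_minus_add)
qed

text \<open>The operation does not lengthen a combination: the scalar of each summand is central and
  comes out in front, while \<open>f x g - g x f\<close> again has coefficients in
  \<open>D\<close>.\<close>

lemma span_commutator:
  assumes R: "cring R" and D: "subring D R" and g: "g \<in> coeff_ring D" and x: "x \<in> coeff_ring D"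
  shows "a \<in> span D n \<Longrightarrow> a \<otimes>\<^bsub>RG\<^esub> (x \<otimes>\<^bsub>RG\<^esub> g) \<ominus>\<^bsub>RG\<^esub> g \<otimes>\<^bsub>RG\<^esub> (x \<otimes>\<^bsub>RG\<^esub> a) \<in> span D n"
proof (induction n arbitrary: a)
  case 0
  then show ?case using g x by (simp add: coeff_ring_def RG.minus_eq)
next
  case (Suc n)
  note E = subringE[OF coeff_ring_subring[OF D]]
  obtain k f a' where a: "a = monom k \<one>\<^bsub>G\<^esub> \<otimes>\<^bsub>RG\<^esub> f \<oplus>\<^bsub>RG\<^esub> a'" and k: "k \<in> carrier R"
    and f: "f \<in> coeff_ring D" and a': "a' \<in> span D n"
    using Suc.prems by auto
  have c: "f \<in> carrier RG" "a' \<in> carrier RG" "g \<in> carrier RG" "x \<in> carrier RG"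
    using f a' g x E(1) span_closed by auto
  have "f \<otimes>\<^bsub>RG\<^esub> (x \<otimes>\<^bsub>RG\<^esub> g) \<ominus>\<^bsub>RG\<^esub> g \<otimes>\<^bsub>RG\<^esub> (x \<otimes>\<^bsub>RG\<^esub> f) \<in> coeff_ring D"
    using f g x E(5-7) by (simp add: RG.minus_eq)
  then show ?case
    unfolding a commutator_split[OF R k c] using k Suc.IH[OF a'] by auto
qed

text \<open>Write \<open>a = k f + a'\<close> as a combination of minimal length \<open>n\<close>. The elements \<open>a x f - f x a\<close> are
  shorter, hence zero, and for generic \<open>x\<close> this says that \<open>a\<close> and \<open>f\<close> are proportional.\<close>

lemma ideal_meets_coeff_ring:
  assumes K: "field R" and nc: "\<not> comm_group G" and lf: "locally_free_group G"
    and D: "subring D R" and I: "ideal I RG" "I \<noteq> {\<zero>\<^bsub>RG\<^esub>}"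
  shows "I \<inter> (coeff_ring D - {\<zero>\<^bsub>RG\<^esub>}) \<noteq> {}"
proof -
  interpret K: field R by fact
  interpret I: ideal I RG by fact
  note E = subringE[OF coeff_ring_subring[OF D]]
  have R: "cring R" by (rule K.is_cring)
  have "I \<inter> (coeff_ring D - {\<zero>\<^bsub>RG\<^esub>}) \<noteq> {}" if "a \<in> I" "a \<in> span D n" "a \<noteq> \<zero>\<^bsub>RG\<^esub>" for a n
    using that
  proof (induction n arbitrary: a)
    case 0
    then show ?case by simp
  next
    case (Suc n)
    obtain k f a' where a: "a = monom k \<one>\<^bsub>G\<^esub> \<otimes>\<^bsub>RG\<^esub> f \<oplus>\<^bsub>RG\<^esub> a'" and k: "k \<in> carrier R"
      and f: "f \<in> coeff_ring D" and a': "a' \<in> span D n"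
      using Suc.prems(2) by auto
    have kc: "monom k \<one>\<^bsub>G\<^esub> \<in> carrier RG" using k by (simp add: monom_closed)
    have fc: "f \<in> carrier RG" and a'c: "a' \<in> carrier RG" using f a' E(1) span_closed by auto
    have ac: "a \<in> carrier RG" using Suc.prems(1) I.Icarr by blast
    define c where "c x = a \<otimes>\<^bsub>RG\<^esub> (x \<otimes>\<^bsub>RG\<^esub> f) \<ominus>\<^bsub>RG\<^esub> f \<otimes>\<^bsub>RG\<^esub> (x \<otimes>\<^bsub>RG\<^esub> a)" for x
    \<comment> \<open>In the first case \<open>a\<close> is already shorter; in the second
      \<open>c x\<close> is a shorter nonzero element of the ideal, since the leading summand
      cancels. The third case is the one that produces an element with coefficients in
      \<open>D\<close>.\<close>
    consider "f = \<zero>\<^bsub>RG\<^esub>" | x where "x \<in> coeff_ring D" "c x \<noteq> \<zero>\<^bsub>RG\<^esub>"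
      | "f \<noteq> \<zero>\<^bsub>RG\<^esub>" "\<And>x. x \<in> coeff_ring D \<Longrightarrow> c x = \<zero>\<^bsub>RG\<^esub>" by blast
    then show ?case
    proof cases
      case 1
      then have "a = a'" using a kc a'c by simp
      then show ?thesis using Suc a' by blast
    next
      case 2
      have xc: "x \<in> carrier RG" using 2 E(1) by blast
      have "c x = monom k \<one>\<^bsub>G\<^esub> \<otimes>\<^bsub>RG\<^esub> (f \<otimes>\<^bsub>RG\<^esub> (x \<otimes>\<^bsub>RG\<^esub> f) \<ominus>\<^bsub>RG\<^esub> f \<otimes>\<^bsub>RG\<^esub> (x \<otimes>\<^bsub>RG\<^esub> f)) \<oplus>\<^bsub>RG\<^esub>
          (a' \<otimes>\<^bsub>RG\<^esub> (x \<otimes>\<^bsub>RG\<^esub> f) \<ominus>\<^bsub>RG\<^esub> f \<otimes>\<^bsub>RG\<^esub> (x \<otimes>\<^bsub>RG\<^esub> a'))"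
        unfolding c_def a by (rule commutator_split[OF R k fc a'c fc xc])
      also have "\<dots> = a' \<otimes>\<^bsub>RG\<^esub> (x \<otimes>\<^bsub>RG\<^esub> f) \<ominus>\<^bsub>RG\<^esub> f \<otimes>\<^bsub>RG\<^esub> (x \<otimes>\<^bsub>RG\<^esub> a')"
        using kc fc xc a'c by (simp add: RG.minus_eq RG.r_neg)
      finally have "c x \<in> span D n" using span_commutator[OF R D f 2(1) a'] by simp
      moreover have "c x \<in> I"
        unfolding c_def RG.minus_eq using Suc.prems(1) fc xc
        by (intro I.a_closed I.a_inv_closed I.I_l_closed I.I_r_closed) auto
      ultimately show ?thesis using Suc.IH 2(2) by blast
    next
      case 3
      let ?S = "supp a \<union> supp f"
      have S: "finite ?S" "?S \<subseteq> carrier G" using finite_supp ac fc supp_subset by auto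
      obtain z where z: "z \<in> carrier G" and inj:
        "\<And>s t s' t'. \<lbrakk>s \<in> ?S; t \<in> ?S; s' \<in> ?S; t' \<in> ?S; s \<otimes>\<^bsub>G\<^esub> (z \<otimes>\<^bsub>G\<^esub> t) = s' \<otimes>\<^bsub>G\<^esub> (z \<otimes>\<^bsub>G\<^esub> t')\<rbrakk> \<Longrightarrow> s = s' \<and> t = t'"
        by (rule generic_element_exists[OF nc lf S]) blast
      let ?z = "monom \<one>\<^bsub>R\<^esub> z"
      have zc: "?z \<in> carrier RG" using z by (simp add: monom_closed)
      have zD: "?z \<in> coeff_ring D"
        using zc subringE(2,3)[OF D] by (simp add: coeff_ring_def monom_def)
      have p: "a \<otimes>\<^bsub>RG\<^esub> (?z \<otimes>\<^bsub>RG\<^esub> f) \<in> carrier RG" "f \<otimes>\<^bsub>RG\<^esub> (?z \<otimes>\<^bsub>RG\<^esub> a) \<in> carrier RG"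
        using ac fc zc by auto
      have "a \<otimes>\<^bsub>RG\<^esub> (?z \<otimes>\<^bsub>RG\<^esub> f) = f \<otimes>\<^bsub>RG\<^esub> (?z \<otimes>\<^bsub>RG\<^esub> a)"
        using 3(2)[OF zD] p unfolding c_def by (metis RG.r_right_minus_eq)
      moreover have "(a \<otimes>\<^bsub>RG\<^esub> (?z \<otimes>\<^bsub>RG\<^esub> f)) (s \<otimes>\<^bsub>G\<^esub> (z \<otimes>\<^bsub>G\<^esub> t)) = a s \<otimes>\<^bsub>R\<^esub> f t"
        "(f \<otimes>\<^bsub>RG\<^esub> (?z \<otimes>\<^bsub>RG\<^esub> a)) (s \<otimes>\<^bsub>G\<^esub> (z \<otimes>\<^bsub>G\<^esub> t)) = f s \<otimes>\<^bsub>R\<^esub> a t"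
        if st: "s \<in> ?S" "t \<in> ?S" for s t
        by (rule mult_generic_monom[OF ac fc z S(2) Un_upper1 Un_upper2 st], erule (4) inj)
          (rule mult_generic_monom[OF fc ac z S(2) Un_upper2 Un_upper1 st], erule (4) inj)
      ultimately have cross: "a s \<otimes>\<^bsub>R\<^esub> f t = f s \<otimes>\<^bsub>R\<^esub> a t" if "s \<in> ?S" "t \<in> ?S" for s t
        using that by metis
      obtain t where t: "t \<in> supp f" using 3(1) fc supp_empty_iff by blast
      have ft: "f t \<noteq> \<zero>\<^bsub>R\<^esub>" using t by (simp add: supp_def)
      note [simp] = RG_closed[OF ac] RG_closed[OF fc]
      \<comment> \<open>Otherwise \<open>cross\<close> gives \<open>a s \<otimes> f t = 0\<close>
        for all \<open>s\<close>, and since \<open>f t \<noteq> 0\<close> this would make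
        \<open>a\<close> zero.\<close>
      have at0: "a t \<noteq> \<zero>\<^bsub>R\<^esub>"
      proof
        assume at0: "a t = \<zero>\<^bsub>R\<^esub>"
        have "a s = \<zero>\<^bsub>R\<^esub>" if "s \<in> supp a" for s
          using cross[of s t] that t at0 ft K.integral_iff[of "a s" "f t"] by simp
        then have "supp a = {}" by (auto simp: supp_def)
        then show False using Suc.prems(3) ac supp_empty_iff by blast
      qed
      \<comment> \<open>The ratio is taken so that \<open>f\<close> becomes a multiple of
        \<open>a\<close>, and not conversely: this puts \<open>f\<close>, which has coefficients in
        \<open>D\<close>, into the ideal.\<close>
      let ?u = "f t \<otimes>\<^bsub>R\<^esub> inv\<^bsub>R\<^esub> (a t)"
      have inv: "inv\<^bsub>R\<^esub> (a t) \<in> carrier R" "a t \<otimes>\<^bsub>R\<^esub> inv\<^bsub>R\<^esub> (a t) = \<one>\<^bsub>R\<^esub>"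
        using at0 K.field_Units by auto
      have uc: "?u \<in> carrier R" using inv by simp
      have fs: "f s = ?u \<otimes>\<^bsub>R\<^esub> a s" for s
      proof (cases "s \<in> ?S")
        case True
        have "f s = f s \<otimes>\<^bsub>R\<^esub> a t \<otimes>\<^bsub>R\<^esub> inv\<^bsub>R\<^esub> (a t)" using inv by (simp add: R.m_assoc)
        also have "\<dots> = a s \<otimes>\<^bsub>R\<^esub> f t \<otimes>\<^bsub>R\<^esub> inv\<^bsub>R\<^esub> (a t)" using cross[OF True, of t] t by simp
        also have "\<dots> = ?u \<otimes>\<^bsub>R\<^esub> a s" using inv by (simp add: R.m_assoc K.m_comm K.m_lcomm)
        finally show ?thesis .
      next
        case False
        then have "f s = \<zero>\<^bsub>R\<^esub>" "a s = \<zero>\<^bsub>R\<^esub>" using not_supp ac fc by auto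
        then show ?thesis using uc by simp
      qed
      have "f = monom ?u \<one>\<^bsub>G\<^esub> \<otimes>\<^bsub>RG\<^esub> a"
        by (rule ext) (simp only: monom_one_mult[OF uc ac], rule fs)
      moreover have "monom ?u \<one>\<^bsub>G\<^esub> \<otimes>\<^bsub>RG\<^esub> a \<in> I"
        by (rule I.I_l_closed[OF Suc.prems(1) monom_closed[OF uc G.one_closed]])
      ultimately show ?thesis using f 3(1) by auto
    qed
  qed
  moreover obtain a where "a \<in> I" "a \<noteq> \<zero>\<^bsub>RG\<^esub>" using I(2) I.zero_closed by blast
  moreover from this obtain n where "a \<in> span D n" using span_exhaustive[OF D] I.Icarr by blast
  ultimately show ?thesis by blast
qed

end

text \<open>The image of the integers is a countable subring, so it is no larger than an infinite
  group, whatever the size of the field.\<close>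

lemma (in cring) int_multiples_subring: "subring (range (\<lambda>n :: int. [n] \<cdot> \<one>)) R"
proof (rule subringI)
  show "range (\<lambda>n :: int. [n] \<cdot> \<one>) \<subseteq> carrier R" by auto
  show "\<one> \<in> range (\<lambda>n :: int. [n] \<cdot> \<one>)" by (rule range_eqI[of _ _ 1]) simp
  show "\<ominus> h \<in> range (\<lambda>n :: int. [n] \<cdot> \<one>)" if "h \<in> range (\<lambda>n :: int. [n] \<cdot> \<one>)" for h
    using that by (auto simp: add.int_pow_neg[symmetric])
  show "h \<otimes> h' \<in> range (\<lambda>n :: int. [n] \<cdot> \<one>)"
    if "h \<in> range (\<lambda>n :: int. [n] \<cdot> \<one>)" "h' \<in> range (\<lambda>n :: int. [n] \<cdot> \<one>)" for h h'
    using that by (auto simp: add_pow_ldistr_int add.int_pow_pow)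
  show "h \<oplus> h' \<in> range (\<lambda>n :: int. [n] \<cdot> \<one>)"
    if "h \<in> range (\<lambda>n :: int. [n] \<cdot> \<one>)" "h' \<in> range (\<lambda>n :: int. [n] \<cdot> \<one>)" for h h'
    using that by (auto simp: add.int_pow_mult[symmetric])
qed

section \<open>Primitivity for domains no larger than the group and for all fields\<close>

theorem theorem1p1:
  fixes G :: "('g, 'b) monoid_scheme"
    and R :: "('r, 'a) ring_scheme"
    and K :: "('k, 'c) ring_scheme"
  assumes "group G" and "\<not> comm_group G" and "locally_free_group G"
    and "\<exists>H. subgroup H G \<and> free_group (G\<lparr>carrier := H\<rparr>) \<and> H \<approx> carrier G"
  shows "(noncomm_domain R \<and> carrier R \<lesssim> carrier G \<longrightarrow> right_primitive (group_ring R G)) \<and>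
         (field K \<longrightarrow> right_primitive (group_ring K G))"
proof (intro conjI impI)
  interpret G: group G by fact
  obtain H where H: "subgroup H G" "free_group (G\<lparr>carrier := H\<rparr>)" "H \<approx> carrier G"
    using assms(4) by blast
  have inf: "infinite (carrier G)"
    using G.locally_free_infinite_spread[OF assms(2,3), of "{}"] finite_subset by (auto simp: spread_def)
  {
    assume R: "noncomm_domain R \<and> carrier R \<lesssim> carrier G"
    then interpret group_ring_context R G
      by (simp add: group_ring_context_def noncomm_domain_def G.is_group)
    show "right_primitive RG"
    proof (rule right_primitive_group_ring[OF _ assms(2,3) H])
      have "carrier RG - {\<zero>\<^bsub>RG\<^esub>} \<lesssim> {f \<in> carrier RG. \<forall>x \<in> carrier G. f x \<in> carrier R}"
        using RG_closed by (intro subset_imp_lepoll) auto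
      also have "\<dots> \<lesssim> carrier G" using R by (intro RG_lepoll[OF inf]) auto
      finally show "carrier RG - {\<zero>\<^bsub>RG\<^esub>} \<lesssim> carrier G" .
      fix I assume I: "ideal I RG" "I \<noteq> {\<zero>\<^bsub>RG\<^esub>}"
      interpret I: ideal I RG by fact
      show "I \<inter> (carrier RG - {\<zero>\<^bsub>RG\<^esub>}) \<noteq> {}"
        using I(2) I.Icarr I.zero_closed by blast
    qed (use R in auto)
  }
  {
    assume K: "field K"
    then interpret K: field K .
    interpret group_ring_context K G
      by (simp add: group_ring_context_def K.ring_axioms G.is_group)
    \<comment> \<open>Every nonzero ideal contains a nonzero element with coefficients in
      \<open>?D\<close>, and there are at most as many such elements as elements of
      \<open>G\<close>. This replaces the bound on the coefficients in the first case.\<close>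
    let ?D = "range (\<lambda>n :: int. [n] \<cdot>\<^bsub>K\<^esub> \<one>\<^bsub>K\<^esub>)"
    have dom: "noncomm_domain K"
      using K.integral by (auto simp: noncomm_domain_def K.ring_axioms)
    show "right_primitive RG"
    proof (rule right_primitive_group_ring[OF dom assms(2,3) H])
      have "coeff_ring ?D - {\<zero>\<^bsub>RG\<^esub>} \<lesssim> {f \<in> carrier RG. \<forall>x \<in> carrier G. f x \<in> ?D}"
        by (intro subset_imp_lepoll) (auto simp: coeff_ring_def)
      also have "\<dots> \<lesssim> carrier G"
        by (intro RG_lepoll[OF inf] countable_lepoll_infinite[OF _ inf]) simp
      finally show "coeff_ring ?D - {\<zero>\<^bsub>RG\<^esub>} \<lesssim> carrier G" .
      show "I \<inter> (coeff_ring ?D - {\<zero>\<^bsub>RG\<^esub>}) \<noteq> {}" if "ideal I RG" "I \<noteq> {\<zero>\<^bsub>RG\<^esub>}" for I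
        by (rule ideal_meets_coeff_ring[OF K assms(2,3) K.int_multiples_subring that])
    qed (auto simp: coeff_ring_def)
  }
qed

end
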